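(* Let $m,K,n_u,n_y\ge1$ be integers, $A,A_i\in\mathbb{R}^{m\times m}$, $B\in\mathbb{R}^{m\times n_u}$, $C,C_i\in\mathbb{R}^{n_y\times m}$ for $i=1,\dots,K$, and $0<\tau_1<\cdots<\tau_K$. Define bounded linear operators, for $x\in\mathbb{R}^m$, $u\in\mathbb{R}^{n_u}$ and $\mathbf{x}=(\mathbf{x}_1,\dots,\mathbf{x}_K)$ with $\mathbf{x}_i\in L_2^m[-1,0]$, by $$\mathcal{T}\begin{bmatrix}x\\ \mathbf{x}\end{bmatrix}(s)=\begin{bmatrix}x\\ \big(x-\int_s^0\mathbf{x}_i(\theta)\,d\theta\big)_{i=1}^K\end{bmatrix},\qquad \mathcal{A}\begin{bmatrix}x\\ \mathbf{x}\end{bmatrix}(s)=\begin{bmatrix}\big(A+\sum_{i=1}^K A_i\big)x-\sum_{i=1}^K\int_{-1}^0A_i\mathbf{x}_i(\theta)\,d\theta\\ \big(\tau_i^{-1}\mathbf{x}_i(s)\big)_{i=1}^K\end{bmatrix},$$ $$\mathcal{B}u=\begin{bmatrix}Bu\\0\end{bmatrix},\qquad \mathcal{C}\begin{bmatrix}x\\ \mathbf{x}\end{bmatrix}=\Big(C+\sum_{i=1}^KC_i\Big)x-\sum_{i=1}^K\int_{-1}^0C_i\mathbf{x}_i(\theta)\,d\theta .$$ Let $\alpha>0$ and $L\in\mathbb{R}^{n_u\times n_y}$. Suppose that for a given 4-PI operator $\mathcal{K}:\mathbb{R}L_2^{m,mK}\to\mathbb{R}^{n_u}$ there exist a 4-PI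 operator $\mathcal{P}=\mathcal{P}^*\in\Pi_{mK,mK}^{m,m}$, matrices $F\in\mathbb{R}^{n_u\times n_u}$, $Z\in\mathbb{R}^{n_u\times n_y}$ and constants $\delta,\epsilon>0$ such that $\mathcal{P}\succcurlyeq\delta I$, $\Phi+\Phi^*\preccurlyeq0$ and $L=F^{-1}Z$, where $\Phi$ is the operator on $\mathbb{R}^{n_u}\times\mathbb{R}L_2^{m,mK}$ given by $$\Phi=\begin{bmatrix}-F+\frac{\epsilon}{2}I&\mathcal{B}^*\mathcal{P}\mathcal{T}+Z\mathcal{C}-F\mathcal{K}\\ 0&\mathcal{T}^*\mathcal{P}(\mathcal{A}+\mathcal{B}\mathcal{K}+\alpha\mathcal{T})\end{bmatrix}.$$ Then there is a constant $M>0$ such that for any $x_0\in W^m[-\tau_K,0]$ and any $x$ satisfying the delay differential equation $$\dot x(t)=Ax(t)+\sum_{i=1}^KA_ix(t-\tau_i)+Bu(t),\qquad y(t)=Cx(t)+\sum_{i=1}^KC_ix(t-\tau_i),\qquad t\ge0,$$ with $u(t)=Ly(t)$ and $x(t)=x_0(t)$ for all $-\tau_K\le t\le0$, we have $$\|x(t)\|_{\mathbb{R}^m}\le M\|x_0\|_{L_\infty}e^{-\alpha t}\qquad\text{for all }t\ge0.$$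
   Context: $L_2^n[a,b]$ is the space of Lebesgue square-integrable $\mathbb{R}^n$-valued functions on $[a,b]$; $W^n[a,b]$ is the Sobolev space of $\mathbb{R}^n$-valued functions in $L_2$ with weak derivative in $L_2$; $\mathbb{R}L_2^{m,n}:=\mathbb{R}^m\times L_2^n[-1,0]$ with its natural Hilbert space inner product; $\|x_0\|_{L_\infty}=\max_{-\tau_K\le t\le0}\|x_0(t)\|_{\mathbb{R}^m}$. 4-PI operators: $\Pi_{q,n}^{p,m}$ is the set of bounded linear operators $\mathcal{P}:\mathbb{R}L_2^{m,n}\to\mathbb{R}L_2^{p,q}$ of the form $$\Big(\mathcal{P}\begin{bmatrix}x\\ \mathbf{x}\end{bmatrix}\Big)(s)=\begin{bmatrix}Px+\int_{-1}^0Q_1(\theta)\mathbf{x}(\theta)\,d\theta\\ Q_2(s)x+R_0(s)\mathbf{x}(s)+\int_{-1}^sR_1(s,\theta)\mathbf{x}(\theta)\,d\theta+\int_s^0R_2(s,\theta)\mathbf{x}(\theta)\,d\theta\end{bmatrix},$$ where $P\in\mathbb{R}^{p\times m}$ is a matrix and $Q_1(s)\in\mathbb{R}^{p\times n}$, $Q_2(s)\in\mathbb{R}^{q\times m}$, $R_0(s),R_1(s,\theta),R_2(s,\theta)\in\mathbb{R}^{q\times n}$ are matrix-valued polynomials. Dimensions may be zero, in which case the corresponding parameters are absent (so operators from or into $\mathbb{R}^k=\mathbb{R}L_2^{k,0}$ are included). $^*$ denotes the Hilbert space adjoint. For self-adjoint $\mathcal{G}$, $\mathcal{G}\succcurlyeq0$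 means $\langle\mathbf{x},\mathcal{G}\mathbf{x}\rangle\ge0$ for all $\mathbf{x}$; $\mathcal{G}\preccurlyeq0$ means $-\mathcal{G}\succcurlyeq0$; $\mathcal{P}\succcurlyeq\delta I$ means $\mathcal{P}-\delta I\succcurlyeq0$. *)

theory Defs
  imports "HOL-Analysis.Analysis"
begin

definition square_integrable_on :: "(real \<Rightarrow> 'a::euclidean_space) \<Rightarrow> real set \<Rightarrow> bool"
    (infixr \<open>square'_integrable'_on\<close> 46)
  where "f square_integrable_on S \<longleftrightarrow>
    f \<in> borel_measurable (lebesgue_on S) \<and> integrable (lebesgue_on S) (\<lambda>s. (norm (f s))\<^sup>2)"

lemma square_integrable_on_zero [simp]: "(\<lambda>_. 0) square_integrable_on S"
  by (simp add: square_integrable_on_def)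

lemma square_integrable_on_scaleR:
  assumes "f square_integrable_on S"
  shows "(\<lambda>s. c *\<^sub>R f s) square_integrable_on S"
  using assms by (auto simp: square_integrable_on_def power_mult_distrib)

lemma square_integrable_on_minus:
  assumes "f square_integrable_on S"
  shows "(\<lambda>s. - f s) square_integrable_on S"
  using assms by (auto simp: square_integrable_on_def)

lemma square_integrable_on_add:
  assumes "f square_integrable_on S" "g square_integrable_on S"
  shows "(\<lambda>s. f s + g s) square_integrable_on S"
proof -
  have "integrable (lebesgue_on S) (\<lambda>s. (norm (f s + g s))\<^sup>2)"
  proof (rule Bochner_Integration.integrable_bound)
    show "integrable (lebesgue_on S) (\<lambda>s. 2 * (norm (f s))\<^sup>2 + 2 * (norm (g s))\<^sup>2)"
      using assms by (auto simp: square_integrable_on_def)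
    show "(\<lambda>s. (norm (f s + g s))\<^sup>2) \<in> borel_measurable (lebesgue_on S)"
      using assms by (auto simp: square_integrable_on_def)
    have "(norm (f s + g s))\<^sup>2 \<le> 2 * (norm (f s))\<^sup>2 + 2 * (norm (g s))\<^sup>2" for s
    proof -
      have "(norm (f s + g s))\<^sup>2 \<le> (norm (f s) + norm (g s))\<^sup>2"
        by (intro power_mono norm_triangle_ineq) auto
      also have "\<dots> \<le> 2 * (norm (f s))\<^sup>2 + 2 * (norm (g s))\<^sup>2"
        using zero_le_power2[of "norm (f s) - norm (g s)"]
        by (simp add: power2_eq_square algebra_simps)
      finally show ?thesis .
    qed
    then show "AE s in lebesgue_on S. norm ((norm (f s + g s))\<^sup>2)
        \<le> norm (2 * (norm (f s))\<^sup>2 + 2 * (norm (g s))\<^sup>2)"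
      by simp
  qed
  then show ?thesis
    using assms by (auto simp: square_integrable_on_def)
qed

lemma integrable_inner_square_integrable:
  assumes "f square_integrable_on S" "g square_integrable_on S"
  shows "integrable (lebesgue_on S) (\<lambda>s. f s \<bullet> g s)"
proof (rule Bochner_Integration.integrable_bound)
  show "integrable (lebesgue_on S) (\<lambda>s. (norm (f s))\<^sup>2 + (norm (g s))\<^sup>2)"
    using assms by (auto simp: square_integrable_on_def)
  show "(\<lambda>s. f s \<bullet> g s) \<in> borel_measurable (lebesgue_on S)"
    using assms by (auto simp: square_integrable_on_def)
  have "\<bar>f s \<bullet> g s\<bar> \<le> (norm (f s))\<^sup>2 + (norm (g s))\<^sup>2" for s
  proof -
    have "\<bar>f s \<bullet> g s\<bar> \<le> norm (f s) * norm (g s)"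
      by (rule Cauchy_Schwarz_ineq2)
    also have "\<dots> \<le> (norm (f s))\<^sup>2 + (norm (g s))\<^sup>2"
      using zero_le_power2[of "norm (f s) - norm (g s)"] zero_le_power2[of "norm (f s)"]
        zero_le_power2[of "norm (g s)"]
      unfolding power2_diff by linarith
    finally show ?thesis .
  qed
  then show "AE s in lebesgue_on S. norm (f s \<bullet> g s) \<le> norm ((norm (f s))\<^sup>2 + (norm (g s))\<^sup>2)"
    by simp
qed

lemma integrable_square_integrable:
  fixes f :: "real \<Rightarrow> 'a::euclidean_space"
  assumes "f square_integrable_on {a..b}"
  shows "integrable (lebesgue_on {a..b}) f"
proof (rule Bochner_Integration.integrable_bound)
  show "integrable (lebesgue_on {a..b}) (\<lambda>s. 1 + (norm (f s))\<^sup>2)"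
    using assms by (auto simp: square_integrable_on_def intro!: integrable_const)
  show "f \<in> borel_measurable (lebesgue_on {a..b})"
    using assms by (auto simp: square_integrable_on_def)
  have "norm (f s) \<le> 1 + (norm (f s))\<^sup>2" for s
    using zero_le_power2[of "norm (f s) - 1"] zero_le_power2[of "norm (f s)"] norm_ge_zero[of "f s"]
    unfolding power2_diff power_one mult_1_right by linarith
  then show "AE s in lebesgue_on {a..b}. norm (f s) \<le> norm (1 + (norm (f s))\<^sup>2)"
    by simp
qed

lemma square_integrable_on_bounded_linear:
  fixes h :: "'a::euclidean_space \<Rightarrow> 'b::euclidean_space"
  assumes h: "bounded_linear h" and f: "f square_integrable_on S"
  shows "(\<lambda>s. h (f s)) square_integrable_on S"
proof -
  have meas: "(\<lambda>s. h (f s)) \<in> borel_measurable (lebesgue_on S)"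
    using f by (intro borel_measurable_continuous_on[of h] linear_continuous_on h)
      (auto simp: square_integrable_on_def)
  obtain K where K: "\<And>v. norm (h v) \<le> norm v * K"
    using bounded_linear.bounded[OF h] by blast
  have "integrable (lebesgue_on S) (\<lambda>s. (norm (h (f s)))\<^sup>2)"
  proof (rule Bochner_Integration.integrable_bound)
    show "integrable (lebesgue_on S) (\<lambda>s. (norm (f s))\<^sup>2 * K\<^sup>2)"
      using f by (auto simp: square_integrable_on_def)
    have "(norm (h (f s)))\<^sup>2 \<le> (norm (f s))\<^sup>2 * K\<^sup>2" for s
      unfolding power_mult_distrib[symmetric] by (intro power_mono K) auto
    then show "AE s in lebesgue_on S.
        norm ((norm (h (f s)))\<^sup>2) \<le> norm ((norm (f s))\<^sup>2 * K\<^sup>2)"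
      by simp
  qed (use meas in measurable)
  with meas show ?thesis
    by (simp add: square_integrable_on_def)
qed

lemma square_integrable_on_continuous:
  fixes f :: "real \<Rightarrow> 'a::euclidean_space"
  assumes "continuous_on {a..b} f"
  shows "f square_integrable_on {a..b}"
proof -
  have "continuous_on {a..b} (\<lambda>s. (norm (f s))\<^sup>2)"
    using assms by (intro continuous_intros)
  then have "integrable (lebesgue_on {a..b}) (\<lambda>s. (norm (f s))\<^sup>2)"
    by (rule continuous_imp_integrable_real)
  moreover have "f \<in> borel_measurable (lebesgue_on {a..b})"
    using assms by (rule continuous_imp_measurable_on_sets_lebesgue) simp
  ultimately show ?thesis
    by (simp add: square_integrable_on_def)
qed

text \<open>
  Elements are classes of square-integrable functions on $[-1,0]$ modulo equality almost
  everywhere; \<open>rep_L2\<close> chooses a representative and \<open>abs_L2\<close> forms the class.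
\<close>

definition L2_eq :: "(real \<Rightarrow> 'a::euclidean_space) \<Rightarrow> (real \<Rightarrow> 'a) \<Rightarrow> bool"
  where "L2_eq f g \<longleftrightarrow> f square_integrable_on {-1..0} \<and> g square_integrable_on {-1..0}
    \<and> (AE s in lebesgue_on {-1..0}. f s = g s)"

quotient_type (overloaded) 'a L2 = "real \<Rightarrow> 'a::euclidean_space" / partial: L2_eq
proof (rule part_equivpI)
  show "\<exists>f::real \<Rightarrow> 'a. L2_eq f f"
    by (rule exI[of _ "\<lambda>_. 0"]) (simp add: L2_eq_def)
  show "symp (L2_eq :: (real \<Rightarrow> 'a) \<Rightarrow> _)"
    by (rule sympI) (auto simp: L2_eq_def)
  show "transp (L2_eq :: (real \<Rightarrow> 'a) \<Rightarrow> _)"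
    by (rule transpI) (auto simp: L2_eq_def)
qed

instantiation L2 :: (euclidean_space) real_inner
begin

lift_definition zero_L2 :: "'a L2" is "\<lambda>_. 0"
  by (simp add: L2_eq_def)

lift_definition plus_L2 :: "'a L2 \<Rightarrow> 'a L2 \<Rightarrow> 'a L2" is "\<lambda>f g s. f s + g s"
  by (auto simp: L2_eq_def square_integrable_on_add)

lift_definition uminus_L2 :: "'a L2 \<Rightarrow> 'a L2" is "\<lambda>f s. - f s"
  by (auto simp: L2_eq_def square_integrable_on_minus)

definition minus_L2 :: "'a L2 \<Rightarrow> 'a L2 \<Rightarrow> 'a L2"
  where "minus_L2 X Y = X + - Y"

lift_definition scaleR_L2 :: "real \<Rightarrow> 'a L2 \<Rightarrow> 'a L2" is "\<lambda>c f s. c *\<^sub>R f s"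
  by (auto simp: L2_eq_def square_integrable_on_scaleR)

lift_definition inner_L2 :: "'a L2 \<Rightarrow> 'a L2 \<Rightarrow> real"
  is "\<lambda>f g. LINT s|lebesgue_on {-1..0}. f s \<bullet> g s"
proof (rule integral_cong_AE)
  fix f f' g g' :: "real \<Rightarrow> 'a"
  assume "L2_eq f f'" "L2_eq g g'"
  then show "(\<lambda>s. f s \<bullet> g s) \<in> borel_measurable (lebesgue_on {-1..0})"
    "(\<lambda>s. f' s \<bullet> g' s) \<in> borel_measurable (lebesgue_on {-1..0})"
    "AE s in lebesgue_on {-1..0}. f s \<bullet> g s = f' s \<bullet> g' s"
    by (auto simp: L2_eq_def square_integrable_on_def)
qed

definition norm_L2 :: "'a L2 \<Rightarrow> real"
  where "norm_L2 X = sqrt (X \<bullet> X)"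

definition sgn_L2 :: "'a L2 \<Rightarrow> 'a L2"
  where "sgn_L2 X = inverse (norm X) *\<^sub>R X"

definition dist_L2 :: "'a L2 \<Rightarrow> 'a L2 \<Rightarrow> real"
  where "dist_L2 X Y = norm (X - Y)"

definition uniformity_L2 :: "('a L2 \<times> 'a L2) filter"
  where "uniformity_L2 = (INF e\<in>{0<..}. principal {(X, Y). dist X Y < e})"

definition open_L2 :: "'a L2 set \<Rightarrow> bool"
  where "open_L2 U \<longleftrightarrow> (\<forall>X\<in>U. \<forall>\<^sub>F (X', Y) in uniformity. X' = X \<longrightarrow> Y \<in> U)"

instance
proof
  fix X Y Z :: "'a L2" and c d :: real and U :: "'a L2 set"
  show "X + Y + Z = X + (Y + Z)"
    by transfer (auto simp: L2_eq_def add.assoc square_integrable_on_add)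
  show "X + Y = Y + X"
    by transfer (auto simp: L2_eq_def add.commute square_integrable_on_add)
  show "0 + X = X"
    by transfer (auto simp: L2_eq_def)
  show "- X + X = 0"
    by transfer (auto simp: L2_eq_def)
  show "X - Y = X + - Y"
    by (rule minus_L2_def)
  show "c *\<^sub>R (X + Y) = c *\<^sub>R X + c *\<^sub>R Y"
    by transfer
      (auto simp: L2_eq_def scaleR_add_right square_integrable_on_add square_integrable_on_scaleR)
  show "(c + d) *\<^sub>R X = c *\<^sub>R X + d *\<^sub>R X"
    by transfer
      (auto simp: L2_eq_def scaleR_add_left square_integrable_on_add square_integrable_on_scaleR)
  show "c *\<^sub>R d *\<^sub>R X = (c * d) *\<^sub>R X"
    by transfer (auto simp: L2_eq_def square_integrable_on_scaleR)
  show "1 *\<^sub>R X = X"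
    by transfer (auto simp: L2_eq_def)
  show "sgn X = inverse (norm X) *\<^sub>R X"
    by (rule sgn_L2_def)
  show "dist X Y = norm (X - Y)"
    by (rule dist_L2_def)
  show "(uniformity :: ('a L2 \<times> 'a L2) filter) = (INF e\<in>{0<..}. principal {(X, Y). dist X Y < e})"
    by (rule uniformity_L2_def)
  show "open U \<longleftrightarrow> (\<forall>X\<in>U. \<forall>\<^sub>F (X', Y) in uniformity. X' = X \<longrightarrow> Y \<in> U)"
    by (rule open_L2_def)
  show "X \<bullet> Y = Y \<bullet> X"
    by transfer (simp add: inner_commute)
  show "(X + Y) \<bullet> Z = X \<bullet> Z + Y \<bullet> Z"
    by transfer (simp add: L2_eq_def inner_add_left integrable_inner_square_integrable)
  show "(c *\<^sub>R X) \<bullet> Y = c * (X \<bullet> Y)"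
    by transfer simp
  show "0 \<le> X \<bullet> X"
    by transfer simp
  show "X \<bullet> X = 0 \<longleftrightarrow> X = 0"
  proof transfer
    fix f :: "real \<Rightarrow> 'a"
    assume "L2_eq f f"
    then have f: "f square_integrable_on {-1..0}"
      by (simp add: L2_eq_def)
    have "(LINT s|lebesgue_on {-1..0}. f s \<bullet> f s) = 0
        \<longleftrightarrow> (AE s in lebesgue_on {-1..0}. f s \<bullet> f s = 0)"
      by (rule integral_nonneg_eq_0_iff_AE[OF integrable_inner_square_integrable[OF f f]]) simp
    then show "(LINT s|lebesgue_on {-1..0}. f s \<bullet> f s) = 0 \<longleftrightarrow> L2_eq f (\<lambda>_. 0)"
      using f by (simp add: L2_eq_def)
  qed
  show "norm X = sqrt (X \<bullet> X)"
    by (rule norm_L2_def)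
qed

end

lemma rep_L2_square_integrable: "rep_L2 X square_integrable_on {-1..0}"
  using Quotient_rep_reflp[OF Quotient_L2, of X] by (simp add: L2_eq_def)

lemma rep_abs_L2:
  assumes "f square_integrable_on {-1..0}"
  shows "AE s in lebesgue_on {-1..0}. rep_L2 (abs_L2 f) s = f s"
  using Quotient_rep_abs[OF Quotient_L2, of f] assms by (simp add: L2_eq_def)

text \<open>The inner product on $\mathbb{R}L_2^{m,n}$ is that of the product instance.\<close>

type_synonym ('m, 'n) RL2 = "(real^'m) \<times> (real^'n) L2"

text \<open>
  The second component of the output is prescribed almost everywhere, that is, as an element
  of $L_2$.  Matrix-valued polynomials in $(s,\theta)$ are polynomial functions on
  \<open>real \<times> real\<close>.
\<close>

definition fourPI :: "(('m::finite, 'n::finite) RL2 \<Rightarrow> ('p::finite, 'q::finite) RL2) set"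
  where "fourPI = {\<P>. bounded_linear \<P> \<and>
    (\<exists>(P :: real^'m^'p) (Q1 :: real \<Rightarrow> real^'n^'p) (Q2 :: real \<Rightarrow> real^'m^'q)
      (R0 :: real \<Rightarrow> real^'n^'q) (R1 :: real \<times> real \<Rightarrow> real^'n^'q)
      (R2 :: real \<times> real \<Rightarrow> real^'n^'q).
      polynomial_function Q1 \<and> polynomial_function Q2 \<and> polynomial_function R0 \<and>
      polynomial_function R1 \<and> polynomial_function R2 \<and>
      (\<forall>x X.
        fst (\<P> (x, X)) = P *v x + (LINT \<theta>|lebesgue_on {-1..0}. Q1 \<theta> *v rep_L2 X \<theta>) \<and>
        (AE s in lebesgue_on {-1..0}.
          rep_L2 (snd (\<P> (x, X))) s =
            Q2 s *v x + R0 s *v rep_L2 X s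
            + (LINT \<theta>|lebesgue_on {-1..s}. R1 (s, \<theta>) *v rep_L2 X \<theta>)
            + (LINT \<theta>|lebesgue_on {s..0}. R2 (s, \<theta>) *v rep_L2 X \<theta>))))}"

text \<open>
  The case $q = 0$ of operators into $\mathbb{R}^p = \mathbb{R}L_2^{p,0}$ needs its own
  definition, since \<open>real^'q\<close> is never zero-dimensional.
\<close>

definition fourPI_fin :: "(('m::finite, 'n::finite) RL2 \<Rightarrow> real^'p::finite) set"
  where "fourPI_fin = {\<P>. bounded_linear \<P> \<and>
    (\<exists>(P :: real^'m^'p) (Q1 :: real \<Rightarrow> real^'n^'p).
      polynomial_function Q1 \<and>
      (\<forall>x X. \<P> (x, X) = P *v x + (LINT \<theta>|lebesgue_on {-1..0}. Q1 \<theta> *v rep_L2 X \<theta>)))}"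

text \<open>The following two order relations are only used for self-adjoint \<open>\<G>\<close>.\<close>

definition op_nonneg :: "('a::real_inner \<Rightarrow> 'a) \<Rightarrow> bool"
  where "op_nonneg \<G> \<longleftrightarrow> (\<forall>x. 0 \<le> x \<bullet> \<G> x)"

definition op_nonpos :: "('a::real_inner \<Rightarrow> 'a) \<Rightarrow> bool"
  where "op_nonpos \<G> \<longleftrightarrow> op_nonneg (\<lambda>x. - \<G> x)"

text \<open>
  Vectors of dimension $mK$ are indexed by pairs \<open>(i, j)\<close> of a delay \<open>i\<close> and a
  coordinate \<open>j\<close>.
\<close>

definition block :: "'k::finite \<Rightarrow> real^('k \<times> 'm::finite) \<Rightarrow> real^'m"
  where "block i v = (\<chi> j. v $ (i, j))"

definition stack :: "('k::finite \<Rightarrow> real^'m::finite) \<Rightarrow> real^('k \<times> 'm)"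
  where "stack f = (\<chi> p. f (fst p) $ snd p)"

definition T_op :: "('m::finite, 'k::finite \<times> 'm) RL2 \<Rightarrow> ('m, 'k \<times> 'm) RL2"
  where "T_op = (\<lambda>(x, X).
    (x, abs_L2 (\<lambda>s. stack (\<lambda>i. x - (LINT \<theta>|lebesgue_on {s..0}. block i (rep_L2 X \<theta>))))))"

definition A_op :: "real^'m^'m \<Rightarrow> ('k \<Rightarrow> real^'m^'m) \<Rightarrow> ('k \<Rightarrow> real) \<Rightarrow>
    ('m::finite, 'k::finite \<times> 'm) RL2 \<Rightarrow> ('m, 'k \<times> 'm) RL2"
  where "A_op A Ad \<tau> = (\<lambda>(x, X).
    ((A + (\<Sum>i\<in>UNIV. Ad i)) *v x
       - (\<Sum>i\<in>UNIV. LINT \<theta>|lebesgue_on {-1..0}. Ad i *v block i (rep_L2 X \<theta>)),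
     abs_L2 (\<lambda>s. stack (\<lambda>i. inverse (\<tau> i) *\<^sub>R block i (rep_L2 X s)))))"

definition B_op :: "real^'u^'m \<Rightarrow> real^'u \<Rightarrow> ('m::finite, 'k::finite \<times> 'm) RL2"
  where "B_op B u = (B *v u, 0)"

definition C_op :: "real^'m^'y \<Rightarrow> ('k \<Rightarrow> real^'m^'y) \<Rightarrow>
    ('m::finite, 'k::finite \<times> 'm) RL2 \<Rightarrow> real^'y"
  where "C_op C Cd = (\<lambda>(x, X).
    (C + (\<Sum>i\<in>UNIV. Cd i)) *v x
      - (\<Sum>i\<in>UNIV. LINT \<theta>|lebesgue_on {-1..0}. Cd i *v block i (rep_L2 X \<theta>)))"

text \<open>
  The functions passed to \<open>abs_L2\<close> above are square-integrable, so no unspecified values of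
  \<open>abs_L2\<close> enter the operators.
\<close>

lemma bounded_linear_block: "bounded_linear (block i :: real^('k::finite \<times> 'm::finite) \<Rightarrow> _)"
  unfolding linear_conv_bounded_linear[symmetric]
  by (rule linearI) (auto simp: block_def vec_eq_iff)

lemma T_op_square_integrable:
  fixes X :: "(real^('k::finite \<times> 'm::finite)) L2"
  shows "(\<lambda>s. stack (\<lambda>i. x - (LINT \<theta>|lebesgue_on {s..0}. block i (rep_L2 X \<theta>))))
    square_integrable_on {-1..0}"
proof (rule square_integrable_on_continuous)
  have "continuous_on {-1..0} (\<lambda>s. LINT \<theta>|lebesgue_on {s..0}. block i (rep_L2 X \<theta>))" for i
  proof -
    have int: "integrable (lebesgue_on {-1..0}) (\<lambda>\<theta>. block i (rep_L2 X \<theta>))"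
      by (intro integrable_square_integrable square_integrable_on_bounded_linear[OF bounded_linear_block] rep_L2_square_integrable)
    have "integrable (lebesgue_on {s..0}) (\<lambda>\<theta>. block i (rep_L2 X \<theta>))" if "s \<in> {-1..0}" for s
      using that by (intro integrable_subinterval[OF int]) auto
    then have "(LINT \<theta>|lebesgue_on {s..0}. block i (rep_L2 X \<theta>))
        = integral {s..0} (\<lambda>\<theta>. block i (rep_L2 X \<theta>))" if "s \<in> {-1..0}" for s
      using that by (intro lebesgue_integral_eq_integral) auto
    moreover have "continuous_on {-1..0} (\<lambda>s. integral {s..0} (\<lambda>\<theta>. block i (rep_L2 X \<theta>)))"
      by (intro indefinite_integral_continuous_1' integrable_on_lebesgue_on int) auto
    ultimately show ?thesis
      by (subst continuous_on_cong[OF refl]) auto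
  qed
  then show "continuous_on {-1..0}
      (\<lambda>s. stack (\<lambda>i. x - (LINT \<theta>|lebesgue_on {s..0}. block i (rep_L2 X \<theta>))))"
    unfolding stack_def by (intro continuous_intros)
qed

lemma A_op_square_integrable:
  fixes X :: "(real^('k::finite \<times> 'm::finite)) L2"
  shows "(\<lambda>s. stack (\<lambda>i. c i *\<^sub>R block i (rep_L2 X s))) square_integrable_on {-1..0}"
proof -
  let ?f = "\<lambda>v :: real^('k \<times> 'm). stack (\<lambda>i. c i *\<^sub>R block i v) :: real^('k \<times> 'm)"
  have "bounded_linear ?f"
    unfolding linear_conv_bounded_linear[symmetric]
    by (rule linearI) (auto simp: block_def stack_def vec_eq_iff algebra_simps)
  then show ?thesis
    by (intro square_integrable_on_bounded_linear[of ?f] rep_L2_square_integrable)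
qed

definition Phi_op ::
  "real^'u^'u \<Rightarrow> real \<Rightarrow> real^'y^'u \<Rightarrow>
   (('m::finite, 'k::finite \<times> 'm) RL2 \<Rightarrow> real^'u) \<Rightarrow>
   (('m, 'k \<times> 'm) RL2 \<Rightarrow> ('m, 'k \<times> 'm) RL2) \<Rightarrow>
   (('m, 'k \<times> 'm) RL2 \<Rightarrow> ('m, 'k \<times> 'm) RL2) \<Rightarrow>
   (('m, 'k \<times> 'm) RL2 \<Rightarrow> ('m, 'k \<times> 'm) RL2) \<Rightarrow>
   (real^'u \<Rightarrow> ('m, 'k \<times> 'm) RL2) \<Rightarrow>
   (('m, 'k \<times> 'm) RL2 \<Rightarrow> real^'y) \<Rightarrow> real \<Rightarrow>
   (real^'u) \<times> ('m, 'k \<times> 'm) RL2 \<Rightarrow> (real^'u) \<times> ('m, 'k \<times> 'm) RL2"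
  where "Phi_op F \<epsilon> Z \<K> \<P> \<T> \<A> \<B> \<C> \<alpha> = (\<lambda>(u, z).
    (- (F *v u) + (\<epsilon> / 2) *\<^sub>R u
       + (adjoint \<B> (\<P> (\<T> z)) + Z *v \<C> z - F *v \<K> z),
     adjoint \<T> (\<P> (\<A> z + \<B> (\<K> z) + \<alpha> *\<^sub>R \<T> z))))"

definition test_function :: "real \<Rightarrow> real \<Rightarrow> (real \<Rightarrow> real) \<Rightarrow> bool"
  where "test_function a b \<phi> \<longleftrightarrow>
    (\<forall>n t. (deriv ^^ n) \<phi> field_differentiable at t) \<and> closure {t. \<phi> t \<noteq> 0} \<subseteq> {a<..<b}"

definition has_weak_derivative_on ::
    "real \<Rightarrow> real \<Rightarrow> (real \<Rightarrow> 'a::euclidean_space) \<Rightarrow> (real \<Rightarrow> 'a) \<Rightarrow> bool"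
  where "has_weak_derivative_on a b f g \<longleftrightarrow>
    (\<forall>\<phi>. test_function a b \<phi> \<longrightarrow>
      (LINT t|lebesgue_on {a..b}. deriv \<phi> t *\<^sub>R f t)
        = - (LINT t|lebesgue_on {a..b}. \<phi> t *\<^sub>R g t))"

text \<open>
  Every class in $W^n[a,b]$ has a unique continuous representative.  Elements are identified
  with it here, because initial conditions are evaluated pointwise.
\<close>

definition sobolev :: "real \<Rightarrow> real \<Rightarrow> (real \<Rightarrow> 'a::euclidean_space) set"
  where "sobolev a b = {f. continuous_on {a..b} f \<and> f square_integrable_on {a..b} \<and>
    (\<exists>g. g square_integrable_on {a..b} \<and> has_weak_derivative_on a b f g)}"

end

theory Submission
  imports Defs
begin

text \<open>
  For a solution \<open>x\<close> of the closed loop let \<open>W t\<close> consist of \<open>x t\<close> and of the histories of \<open>x\<close> over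
  the delay intervals, rescaled to \<open>[-1, 0]\<close>.  If \<open>x\<close> is continuously differentiable then \<open>W = T_op z\<close>,
  where the state \<open>z\<close> carries the derivative of the histories (\<open>T_op_pie_state\<close>), and \<open>W\<close> is
  differentiable in \<open>\<real>L\<^sub>2\<close> with derivative \<open>W' = A_op A Ad \<tau> z + B_op B u\<close>
  (\<open>has_vector_derivative_history\<close>, \<open>A_op_pie_state\<close>).  The Lyapunov functional is \<open>V = W \<bullet> \<P> W\<close>.

  The inequality for \<open>\<Phi>\<close>, read at the vector \<open>(u - \<K> z, z)\<close>, is the dissipation inequality for \<open>V\<close>.
  Since \<open>F *v u = Z *v y\<close> for the feedback \<open>u = L *v y\<close>, the terms with \<open>F\<close> and \<open>Z\<close> cancel, the
  auxiliary feedback \<open>\<K>\<close> survives only in a square, and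
  \<open>W \<bullet> \<P> W' + \<alpha> * V \<le> - \<epsilon> / 2 * (norm (u - \<K> z))\<^sup>2 \<le> 0\<close> remains (\<open>Phi_op_quadratic_form\<close>).
  The same inequality at \<open>(v, 0)\<close> shows that \<open>F\<close> is invertible.  Hence \<open>V t \<le> exp (- 2 * \<alpha> * t) * V 0\<close>
  (\<open>dissipation_imp_decay\<close>).  As \<open>V\<close> dominates \<open>\<delta> * (norm (x t))\<^sup>2\<close>, and \<open>V 0\<close> is at most a multiple of
  the squared supremum of the initial history, this is the claimed estimate
  (\<open>coercive_decay_bound\<close>).

  Two gaps remain.  The initial history has only a square-integrable weak derivative, so \<open>W\<close> need not
  be classically differentiable at early times.  But the estimate involves only suprema of \<open>x\<close>, and the
  averages of \<open>x\<close> over short time intervals solve the same equation, are continuously differentiable,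
  and converge to \<open>x\<close> locally uniformly; so it suffices to prove the estimate for continuously
  differentiable solutions (\<open>delay_bound_by_averaging\<close>).  Secondly, the adjoints in \<open>\<Phi>\<close> have to exist.
  This follows from the Riesz representation theorem, since \<open>L\<^sub>2\<close> is complete and all operators
  involved are bounded (\<open>inner_adjoint\<close>, \<open>bounded_linear_Phi_op\<close>).
\<close>

section \<open>Completeness of the space of square-integrable classes\<close>

lemma abs_rep_L2 [simp]: "abs_L2 (rep_L2 X) = X"
  by (rule Quotient_abs_rep[OF Quotient_L2])

lemma rep_L2_measurable [measurable]: "rep_L2 X \<in> borel_measurable (lebesgue_on {-1..0})"
  using rep_L2_square_integrable[of X] by (simp add: square_integrable_on_def)

lemma abs_L2_cong:
  assumes "f square_integrable_on {-1..0}" "g square_integrable_on {-1..0}"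
    and "AE s in lebesgue_on {-1..0}. f s = g s"
  shows "abs_L2 f = abs_L2 g"
  using assms by (intro Quotient_rel_abs[OF Quotient_L2]) (simp add: L2_eq_def)

lemma abs_L2_add:
  assumes "f square_integrable_on {-1..0}" "g square_integrable_on {-1..0}"
  shows "abs_L2 (\<lambda>s. f s + g s) = abs_L2 f + abs_L2 g"
  using assms by (subst plus_L2.abs_eq) (auto simp: L2_eq_def)

lemma abs_L2_scaleR:
  assumes "f square_integrable_on {-1..0}"
  shows "abs_L2 (\<lambda>s. c *\<^sub>R f s) = c *\<^sub>R abs_L2 f"
  using assms by (subst scaleR_L2.abs_eq) (auto simp: L2_eq_def)

lemma square_integrable_on_diff:
  assumes "f square_integrable_on S" "g square_integrable_on S"
  shows "(\<lambda>s. f s - g s) square_integrable_on S"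
  using square_integrable_on_add[OF assms(1) square_integrable_on_minus[OF assms(2)]] by simp

lemma abs_L2_diff:
  assumes "f square_integrable_on {-1..0}" "g square_integrable_on {-1..0}"
  shows "abs_L2 (\<lambda>s. f s - g s) = abs_L2 f - abs_L2 g"
  using abs_L2_add[OF assms(1) square_integrable_on_minus[OF assms(2)]] 
    abs_L2_scaleR[OF assms(2), of "-1"] by simp

lemma norm_abs_L2:
  assumes "f square_integrable_on {-1..0}"
  shows "(norm (abs_L2 f))\<^sup>2 = (LINT s|lebesgue_on {-1..0}. (norm (f s))\<^sup>2)"
  using assms
  by (simp add: power2_norm_eq_inner inner_L2.abs_eq L2_eq_def)

lemma norm_L2_rep: "(norm X)\<^sup>2 = (LINT s|lebesgue_on {-1..0}. (norm (rep_L2 X s))\<^sup>2)"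
  using norm_abs_L2[OF rep_L2_square_integrable[of X]] by simp

lemma norm_abs_L2_le:
  assumes f: "f square_integrable_on {-1..0}"
    and c: "\<And>s. s \<in> {-1..0} \<Longrightarrow> norm (f s) \<le> c" 
  shows "norm (abs_L2 f) \<le> c"
proof -
  have c0: "0 \<le> c" using order_trans[OF norm_ge_zero c[of 0]] by simp
  have "(norm (abs_L2 f))\<^sup>2 \<le> (LINT s|lebesgue_on {-1..0::real}. c\<^sup>2)"
    unfolding norm_abs_L2[OF f] 
    by (rule integral_mono) 
      (use f c in \<open>auto simp: square_integrable_on_def intro!: power_mono integrable_const\<close>)
  also have "\<dots> = c\<^sup>2" by (simp add: measure_restrict_space)
  finally show ?thesis using c0 by (rule power2_le_imp_le)
qed

text \<open>
  The interval has length one, so this is Jensen's inequality: integrate the nonnegative function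
  \<open>(norm X - c)\<^sup>2\<close>, where \<open>c\<close> is the mean of \<open>norm X\<close>.
\<close>

lemma L1_norm_le_L2_norm:
  "(LINT s|lebesgue_on {-1..0}. norm (rep_L2 X s)) \<le> norm X"
proof -
  let ?M = "lebesgue_on {-1..0::real}"
  define c where "c = (LINT s|?M. norm (rep_L2 X s))"
  have i2: "integrable ?M (\<lambda>s. (norm (rep_L2 X s))\<^sup>2)"
    using rep_L2_square_integrable[of X] by (simp add: square_integrable_on_def)
  have i1: "integrable ?M (\<lambda>s. norm (rep_L2 X s))"
    using integrable_square_integrable[OF rep_L2_square_integrable[of X]] by simp
  have ic: "integrable ?M (\<lambda>s. c\<^sup>2)" by simp
  have "0 \<le> (LINT s|?M. (norm (rep_L2 X s) - c)\<^sup>2)" by simp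
  also have "\<dots> = (LINT s|?M. (norm (rep_L2 X s))\<^sup>2 + c\<^sup>2 - 2 * c * norm (rep_L2 X s))"
    by (simp add: power2_diff mult_ac)
  also have "\<dots> = (norm X)\<^sup>2 + c\<^sup>2 - 2 * c * c"
    using i1 i2 ic by (simp add: norm_L2_rep c_def[symmetric] measure_restrict_space)
  finally have "c\<^sup>2 \<le> (norm X)\<^sup>2" by (simp add: power2_eq_square)
  then show ?thesis unfolding c_def by (rule power2_le_imp_le) simp
qed

text \<open>
  Fatou's lemma, applied to the squared norms, bounds the norm of a pointwise limit by the norms of
  the approximants.
\<close>

lemma L2_fatou:
  fixes F :: "real \<Rightarrow> 'a::euclidean_space"
  assumes g: "\<And>n. g n square_integrable_on {-1..0}"
    and F: "F \<in> borel_measurable (lebesgue_on {-1..0})"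
    and lim: "AE s in lebesgue_on {-1..0}. (\<lambda>n. g n s) \<longlonglongrightarrow> F s"
    and e: "eventually (\<lambda>n. norm (abs_L2 (g n)) \<le> e) sequentially" and e0: "0 \<le> e"
  shows "F square_integrable_on {-1..0}" "norm (abs_L2 F) \<le> e"
proof -
  let ?M = "lebesgue_on {-1..0::real}"
  have [measurable]: "F \<in> borel_measurable ?M" "\<And>n. g n \<in> borel_measurable ?M"
    using F g by (auto simp: square_integrable_on_def)
  have gn: "(\<integral>\<^sup>+s. ennreal ((norm (g n s))\<^sup>2) \<partial>?M) = ennreal ((norm (abs_L2 (g n)))\<^sup>2)" for n
    unfolding norm_abs_L2[OF g] using g[of n]
    by (intro nn_integral_eq_integral) (auto simp: square_integrable_on_def)
  have "(\<integral>\<^sup>+s. ennreal ((norm (F s))\<^sup>2) \<partial>?M)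
      = (\<integral>\<^sup>+s. liminf (\<lambda>n. ennreal ((norm (g n s))\<^sup>2)) \<partial>?M)"
  proof (rule nn_integral_cong_AE, use lim in eventually_elim)
    case (elim s)
    then have "(\<lambda>n. ennreal ((norm (g n s))\<^sup>2)) \<longlonglongrightarrow> ennreal ((norm (F s))\<^sup>2)"
      by (intro tendsto_intros tendsto_ennrealI)
    then show ?case
      by (intro lim_imp_Liminf[symmetric]) auto
  qed
  also have "\<dots> \<le> liminf (\<lambda>n. \<integral>\<^sup>+s. ennreal ((norm (g n s))\<^sup>2) \<partial>?M)"
    by (intro nn_integral_liminf) measurable
  also have "\<dots> \<le> liminf (\<lambda>n::nat. ennreal (e\<^sup>2))"
    unfolding gn using e
    by (intro Liminf_mono, elim eventually_mono) (auto intro!: ennreal_leI power_mono)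
  also have "\<dots> = ennreal (e\<^sup>2)" by (simp add: Liminf_const)
  finally have le: "(\<integral>\<^sup>+s. ennreal ((norm (F s))\<^sup>2) \<partial>?M) \<le> ennreal (e\<^sup>2)" .
  have int: "integrable ?M (\<lambda>s. (norm (F s))\<^sup>2)"
    by (rule integrableI_bounded) (use le in \<open>auto simp: le_less_trans\<close>)
  then show F': "F square_integrable_on {-1..0}"
    by (simp add: square_integrable_on_def)
  have "ennreal ((norm (abs_L2 F))\<^sup>2) \<le> ennreal (e\<^sup>2)"
    using le nn_integral_eq_integral[OF int] unfolding norm_abs_L2[OF F'] by simp
  then show "norm (abs_L2 F) \<le> e"
    using e0 by (auto intro: power2_le_imp_le)
qed

text \<open>
  The Riesz-Fischer theorem.  On an interval of length one the \<open>L\<^sub>2\<close> norm dominates the \<open>L\<^sub>1\<close> norm,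
  so a Cauchy sequence has a subsequence that converges almost everywhere.  Fatou's lemma along this
  subsequence turns the Cauchy estimate into an estimate of the distance to the pointwise limit.
\<close>

instance L2 :: (euclidean_space) complete_space
proof
  fix X :: "nat \<Rightarrow> 'a L2"
  assume X: "Cauchy X"
  let ?M = "lebesgue_on {-1..0::real}"
  have sq: "rep_L2 Y square_integrable_on {-1..0}" for Y :: "'a L2"
    by (rule rep_L2_square_integrable)
  have "\<exists>N. \<forall>i\<ge>N. \<forall>j\<ge>N. (LINT s|?M. norm (rep_L2 (X i) s - rep_L2 (X j) s)) < e" if e: "e > 0" for e
  proof -
    obtain N where N: "\<forall>i\<ge>N. \<forall>j\<ge>N. norm (X i - X j) < e"
      using CauchyD[OF X e] by blast
    have "(LINT s|?M. norm (rep_L2 (X i) s - rep_L2 (X j) s)) \<le> norm (X i - X j)" for i j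
    proof -
      have *: "X i - X j = abs_L2 (\<lambda>s. rep_L2 (X i) s - rep_L2 (X j) s)"
        using abs_L2_diff[OF sq sq] by simp
      have "(LINT s|?M. norm (rep_L2 (X i) s - rep_L2 (X j) s))
          = (LINT s|?M. norm (rep_L2 (X i - X j) s))"
        unfolding *
        using rep_abs_L2[OF square_integrable_on_diff[OF sq[of "X i"] sq[of "X j"]]]
        by (intro integral_cong_AE; measurable) auto
      then show ?thesis using L1_norm_le_L2_norm[of "X i - X j"] by simp
    qed
    then show ?thesis using N by (meson le_less_trans)
  qed
  then obtain r where r: "strict_mono r" and "AE s in ?M. Cauchy (\<lambda>i. rep_L2 (X (r i)) s)"
    using cauchy_L1_AE_cauchy_subseq[of ?M "\<lambda>i. rep_L2 (X i)"] integrable_square_integrable[OF sq]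
    by blast
  define F where "F s = lim (\<lambda>i. rep_L2 (X (r i)) s)" for s
  have lim: "AE s in ?M. (\<lambda>i. rep_L2 (X (r i)) s) \<longlonglongrightarrow> F s"
    using \<open>AE s in ?M. Cauchy (\<lambda>i. rep_L2 (X (r i)) s)\<close>
    by eventually_elim (auto simp: F_def Cauchy_convergent_iff convergent_LIMSEQ_iff)
  have Fm [measurable]: "F \<in> borel_measurable ?M"
    unfolding F_def by measurable
  have est: "\<exists>N. \<forall>n\<ge>N. (\<lambda>s. F s - rep_L2 (X n) s) square_integrable_on {-1..0} \<and>
      norm (abs_L2 (\<lambda>s. F s - rep_L2 (X n) s)) \<le> e" if e: "e > 0" for e
  proof -
    obtain N where N: "\<forall>i\<ge>N. \<forall>j\<ge>N. norm (X i - X j) < e"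
      using CauchyD[OF X e] by blast
    have "(\<lambda>s. F s - rep_L2 (X n) s) square_integrable_on {-1..0} \<and>
      norm (abs_L2 (\<lambda>s. F s - rep_L2 (X n) s)) \<le> e" if n: "n \<ge> N" for n
    proof -
      let ?g = "\<lambda>i s. rep_L2 (X (r i)) s - rep_L2 (X n) s"
      have g: "?g i square_integrable_on {-1..0}" for i
        by (rule square_integrable_on_diff[OF sq sq])
      have "AE s in ?M. (\<lambda>i. ?g i s) \<longlonglongrightarrow> F s - rep_L2 (X n) s"
        using lim by eventually_elim (intro tendsto_intros)
      moreover have "eventually (\<lambda>i. norm (abs_L2 (?g i)) \<le> e) sequentially"
        unfolding eventually_sequentially abs_L2_diff[OF sq sq] abs_rep_L2
        using N n r by (meson le_trans less_imp_le seq_suble)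
      ultimately show ?thesis
        using L2_fatou[OF g, where F = "\<lambda>s. F s - rep_L2 (X n) s" and e = e] e by simp
    qed
    then show ?thesis by blast
  qed
  obtain N1 where "(\<lambda>s. F s - rep_L2 (X N1) s) square_integrable_on {-1..0}"
    using est[of 1] by auto
  from square_integrable_on_add[OF this sq[of "X N1"]] have Fsq: "F square_integrable_on {-1..0}"
    by simp
  have "X \<longlonglongrightarrow> abs_L2 F"
  proof (rule LIMSEQ_I)
    fix e :: real assume "e > 0"
    then obtain N where "\<forall>n\<ge>N. norm (abs_L2 (\<lambda>s. F s - rep_L2 (X n) s)) \<le> e / 2"
      using est[of "e / 2"] by auto
    then have "\<forall>n\<ge>N. norm (X n - abs_L2 F) < e"
      unfolding abs_L2_diff[OF Fsq sq] abs_rep_L2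
      using \<open>e > 0\<close> by (fastforce simp: norm_minus_commute)
    then show "\<exists>N. \<forall>n\<ge>N. norm (X n - abs_L2 F) < e" by blast
  qed
  then show "convergent X" by (auto simp: convergent_def)
qed

section \<open>Adjoints of bounded operators on complete inner product spaces\<close>

text \<open>
  The representing vector of \<open>f\<close> minimises \<open>x \<bullet> x - 2 * f x\<close>: by the parallelogram identity
  every minimising sequence is Cauchy, and at the minimum the linear term of every perturbation
  vanishes.
\<close>

lemma riesz_representation:
  fixes f :: "'a::{real_inner, complete_space} \<Rightarrow> real"
  assumes f: "bounded_linear f"
  shows "\<exists>v. \<forall>x. f x = x \<bullet> v"
proof -
  interpret f: bounded_linear f by (rule f)
  define J where "J x = x \<bullet> x - 2 * f x" for x
  obtain K where K: "\<And>x. norm (f x) \<le> norm x * K"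
    using f.bounded by blast
  have lower: "- K\<^sup>2 \<le> J x" for x
  proof -
    have "f x \<le> norm x * K" using K[of x] by simp
    then have "J x \<ge> (norm x)\<^sup>2 - 2 * (norm x * K)"
      by (simp add: J_def power2_norm_eq_inner)
    moreover have "(norm x)\<^sup>2 - 2 * (norm x * K) + K\<^sup>2 = (norm x - K)\<^sup>2"
      by (simp add: power2_diff)
    ultimately show ?thesis using zero_le_power2[of "norm x - K"] by linarith
  qed
  define m where "m = (INF x. J x)"
  have bdd: "bdd_below (range J)" using lower by (intro bdd_belowI) auto
  have m_le: "m \<le> J x" for x unfolding m_def by (rule cINF_lower[OF bdd]) simp
  have "\<exists>x. J x < m + inverse (real (Suc n))" for n
  proof (rule ccontr)
    assume "\<not> ?thesis"
    then have "m + inverse (real (Suc n)) \<le> m"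
      unfolding m_def by (intro cINF_greatest) (auto simp: not_less)
    then show False by simp
  qed
  then obtain X where X: "\<And>n. J (X n) < m + inverse (real (Suc n))" by metis
  have par: "(norm (x - y))\<^sup>2 = 2 * J x + 2 * J y - 4 * J ((1/2) *\<^sub>R (x + y))" for x y
    by (simp add: J_def power2_norm_eq_inner inner_simps f.scaleR f.add inner_commute algebra_simps)
  have "Cauchy X"
  proof (rule CauchyI)
    fix e :: real assume e: "e > 0"
    obtain N where N: "inverse (real (Suc N)) < e\<^sup>2 / 4"
      using reals_Archimedean[of "e\<^sup>2 / 4"] e by auto
    have "norm (X i - X j) < e" if "i \<ge> N" "j \<ge> N" for i j
    proof -
      have s: "J (X k) < m + e\<^sup>2 / 4" if "k \<ge> N" for k
        using X[of k] N that by (smt (verit) le_imp_inverse_le of_nat_0_less_iff of_nat_le_iff Suc_le_mono zero_less_Suc)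
      have "(norm (X i - X j))\<^sup>2 < e\<^sup>2"
        unfolding par using s[OF \<open>i \<ge> N\<close>] s[OF \<open>j \<ge> N\<close>] m_le[of "(1/2) *\<^sub>R (X i + X j)"] by linarith
      then show ?thesis using e by (auto intro: power_less_imp_less_base)
    qed
    then show "\<exists>N. \<forall>i\<ge>N. \<forall>j\<ge>N. norm (X i - X j) < e" by blast
  qed
  then obtain v where v: "X \<longlonglongrightarrow> v"
    using Cauchy_convergent convergent_def by blast
  have "(\<lambda>n. J (X n)) \<longlonglongrightarrow> J v"
    unfolding J_def by (intro tendsto_intros v f.tendsto)
  moreover have "(\<lambda>n. m + inverse (real (Suc n))) \<longlonglongrightarrow> m + 0"
    by (intro tendsto_intros LIMSEQ_inverse_real_of_nat)
  ultimately have "J v \<le> m + 0"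
    by (rule LIMSEQ_le) (use X in \<open>auto intro: less_imp_le\<close>)
  then have min: "J v \<le> J x" for x using m_le[of x] by simp
  have "f x = x \<bullet> v" for x
  proof (cases "x = 0")
    case True
    then show ?thesis by (simp add: f.zero)
  next
    case False
    define d where "d = x \<bullet> v - f x"
    define t where "t = - d / (x \<bullet> x)"
    have "J (v + t *\<^sub>R x) = J v + 2 * t * d + t\<^sup>2 * (x \<bullet> x)"
      by (simp add: J_def d_def inner_simps f.scaleR f.add inner_commute power2_eq_square algebra_simps)
    moreover have "2 * t * d + t\<^sup>2 * (x \<bullet> x) = - d\<^sup>2 / (x \<bullet> x)"
      using False by (simp add: t_def power2_eq_square field_simps)
    ultimately have "d\<^sup>2 / (x \<bullet> x) \<le> 0" using min[of "v + t *\<^sub>R x"] by simp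
    then have "d\<^sup>2 \<le> 0" using False by (simp add: divide_le_0_iff not_le flip: inner_gt_zero_iff)
    then show ?thesis by (simp add: d_def)
  qed
  then show ?thesis by blast
qed

text \<open>
  \<open>adjoint\<close> is defined by choice, so it is meaningful only once some adjoint is known to exist.  The Riesz representation theorem supplies one, in any dimension.
\<close>

lemma inner_adjoint:
  fixes f :: "'a::{real_inner, complete_space} \<Rightarrow> 'b::real_inner"
  assumes f: "bounded_linear f"
  shows "x \<bullet> adjoint f y = f x \<bullet> y"
proof -
  have "\<forall>y. \<exists>v. \<forall>x. f x \<bullet> y = x \<bullet> v"
    using f by (intro allI riesz_representation bounded_linear_compose[OF bounded_linear_inner_left])
  then have "\<exists>f'. \<forall>x y. f x \<bullet> y = x \<bullet> f' y" by metis
  then show ?thesis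
    unfolding adjoint_def by (rule someI2_ex) simp
qed

lemma bounded_linear_adjoint:
  fixes f :: "'a::{real_inner, complete_space} \<Rightarrow> 'b::real_inner"
  assumes f: "bounded_linear f"
  shows "bounded_linear (adjoint f)"
proof -
  obtain K where K: "\<And>x. norm (f x) \<le> norm x * K" and "0 \<le> K"
    using bounded_linear.nonneg_bounded[OF f] by blast
  show ?thesis
  proof (rule bounded_linear_intro)
    show "adjoint f (x + y) = adjoint f x + adjoint f y" for x y
      by (rule vector_eq_ldot[THEN iffD1]) (simp add: inner_adjoint[OF f] inner_simps)
    show "adjoint f (c *\<^sub>R x) = c *\<^sub>R adjoint f x" for c x
      by (rule vector_eq_ldot[THEN iffD1]) (simp add: inner_adjoint[OF f] inner_simps)
    show "norm (adjoint f y) \<le> norm y * K" for y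
    proof (cases "adjoint f y = 0")
      case True
      then show ?thesis using \<open>0 \<le> K\<close> by simp
    next
      case False
      have "norm (adjoint f y) * norm (adjoint f y) = f (adjoint f y) \<bullet> y"
        by (simp add: inner_adjoint[OF f, symmetric] norm_eq_sqrt_inner)
      also have "\<dots> \<le> norm (f (adjoint f y)) * norm y"
        by (rule norm_cauchy_schwarz)
      also have "\<dots> \<le> norm (adjoint f y) * K * norm y"
        by (intro mult_right_mono K) simp
      finally show ?thesis using False by (simp add: mult_ac)
    qed
  qed
qed

section \<open>Boundedness of the operators of the partial integral equation\<close>

lemma stack_add: "stack (\<lambda>i. f i + g i) = stack f + stack g"
  and stack_scaleR: "stack (\<lambda>i. c *\<^sub>R f i) = c *\<^sub>R stack f"
  and stack_diff: "stack (\<lambda>i. f i - g i) = stack f - stack g"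
  and block_stack [simp]: "block i (stack f) = f i"
  and stack_block [simp]: "stack (\<lambda>i. block i v) = v"
  by (simp_all add: stack_def block_def vec_eq_iff)

lemma norm_stack: "norm (stack f) = L2_set (\<lambda>i. norm (f i)) UNIV"
proof -
  have "(\<Sum>p\<in>UNIV \<times> UNIV. (f (fst p) $ snd p)\<^sup>2) = (\<Sum>i\<in>UNIV. \<Sum>j\<in>UNIV. (f i $ j)\<^sup>2)"
    by (simp add: sum.cartesian_product split_beta)
  then show ?thesis
    by (simp add: norm_vec_def L2_set_def stack_def real_sqrt_pow2 sum_nonneg)
qed

lemma norm_stack_le: "norm (stack f) \<le> (\<Sum>i\<in>UNIV. norm (f i))"
  unfolding norm_stack by (rule L2_set_le_sum) simp

lemma norm_block_le: "norm (block i v) \<le> norm v"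
proof -
  have "norm (block i v) \<le> L2_set (\<lambda>i. norm (block i v)) UNIV"
    by (rule member_le_L2_set) auto
  then show ?thesis by (simp add: norm_stack[symmetric])
qed

lemma plus_L2_eq_abs: "X + Y = abs_L2 (\<lambda>s. rep_L2 X s + rep_L2 Y s)"
  by (subst abs_L2_add[OF rep_L2_square_integrable rep_L2_square_integrable]) simp

lemma scaleR_L2_eq_abs: "c *\<^sub>R X = abs_L2 (\<lambda>s. c *\<^sub>R rep_L2 X s)"
  by (subst abs_L2_scaleR[OF rep_L2_square_integrable]) simp

lemma AE_lebesgue_on_subset:
  assumes "AE s in lebesgue_on T. P s" "S \<subseteq> T" "S \<in> sets lebesgue" "T \<in> sets lebesgue"
  shows "AE s in lebesgue_on S. P s"
  using assms by (auto simp: AE_restrict_space_iff elim: eventually_mono)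

context
  fixes h :: "'a::euclidean_space \<Rightarrow> 'b::euclidean_space" and a b :: real
  assumes h: "bounded_linear h" and ab: "-1 \<le> a" "b \<le> 0"
begin

lemma integrable_bounded_linear_subinterval:
  assumes "f square_integrable_on {-1..0}"
  shows "integrable (lebesgue_on {a..b}) (\<lambda>\<theta>. h (f \<theta>))"
  using ab
  by (intro integrable_subinterval[OF integrable_square_integrable
        [OF square_integrable_on_bounded_linear[OF h assms]]]) auto

lemma LINT_rep_abs_L2:
  assumes f: "f square_integrable_on {-1..0}"
  shows "(LINT \<theta>|lebesgue_on {a..b}. h (rep_L2 (abs_L2 f) \<theta>)) = (LINT \<theta>|lebesgue_on {a..b}. h (f \<theta>))"
proof (rule integral_cong_AE)
  have "AE s in lebesgue_on {a..b}. rep_L2 (abs_L2 f) s = f s"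
    by (rule AE_lebesgue_on_subset[OF rep_abs_L2[OF f]]) (use ab in auto)
  then show "AE s in lebesgue_on {a..b}. h (rep_L2 (abs_L2 f) s) = h (f s)"
    by eventually_elim simp
qed (intro borel_measurable_integrable integrable_bounded_linear_subinterval f rep_L2_square_integrable)+

lemma norm_LINT_rep_L2_le:
  assumes K: "\<And>v. norm (h v) \<le> norm v * K"
  shows "norm (LINT \<theta>|lebesgue_on {a..b}. h (rep_L2 X \<theta>)) \<le> norm X * K"
proof -
  have K0: "0 \<le> K"
    using order_trans[OF norm_ge_zero K, of "SOME v. v \<in> Basis"] by (simp add: some_in_eq)
  have i: "integrable (lebesgue_on {-1..0}) (\<lambda>s. norm (rep_L2 X s))"
    by (intro integrable_norm integrable_square_integrable rep_L2_square_integrable)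
  have "norm (LINT \<theta>|lebesgue_on {a..b}. h (rep_L2 X \<theta>))
      \<le> (LINT \<theta>|lebesgue_on {a..b}. norm (h (rep_L2 X \<theta>)))"
    by (rule integral_norm_bound)
  also have "\<dots> \<le> (LINT \<theta>|lebesgue_on {-1..0}. norm (rep_L2 X \<theta>) * K)"
    by (rule integral_mono_lebesgue_on_AE) (use i ab K K0 in auto)
  also have "\<dots> = (LINT \<theta>|lebesgue_on {-1..0}. norm (rep_L2 X \<theta>)) * K" using i by simp
  also have "\<dots> \<le> norm X * K"
    by (intro mult_right_mono L1_norm_le_L2_norm K0)
  finally show ?thesis .
qed

lemma bounded_linear_LINT_rep_L2:
  "bounded_linear (\<lambda>X. LINT \<theta>|lebesgue_on {a..b}. h (rep_L2 X \<theta>))"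
proof -
  interpret h: bounded_linear h by (rule h)
  note rep = rep_L2_square_integrable
  obtain K where K: "\<And>v. norm (h v) \<le> norm v * K" using h.bounded by blast
  show ?thesis
  proof (rule bounded_linear_intro)
    fix X Y :: "'a L2" and c :: real
    show "(LINT \<theta>|lebesgue_on {a..b}. h (rep_L2 (X + Y) \<theta>)) =
        (LINT \<theta>|lebesgue_on {a..b}. h (rep_L2 X \<theta>)) + (LINT \<theta>|lebesgue_on {a..b}. h (rep_L2 Y \<theta>))"
      "(LINT \<theta>|lebesgue_on {a..b}. h (rep_L2 (c *\<^sub>R X) \<theta>)) = c *\<^sub>R (LINT \<theta>|lebesgue_on {a..b}. h (rep_L2 X \<theta>))"
      unfolding plus_L2_eq_abs[of X Y] scaleR_L2_eq_abs[of c X]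
        LINT_rep_abs_L2[OF square_integrable_on_add[OF rep rep]]
        LINT_rep_abs_L2[OF square_integrable_on_scaleR[OF rep]] h.add h.scaleR
      by (intro Bochner_Integration.integral_add integral_scaleR_right
          integrable_bounded_linear_subinterval rep)+
    show "norm (LINT \<theta>|lebesgue_on {a..b}. h (rep_L2 X \<theta>)) \<le> norm X * K"
      by (rule norm_LINT_rep_L2_le[OF K])
  qed
qed

end

lemma norm_abs_L2_comp_le:
  fixes h :: "'a::euclidean_space \<Rightarrow> 'b::euclidean_space"
  assumes h: "bounded_linear h" and K: "\<And>v. norm (h v) \<le> norm v * K" and "0 \<le> K"
  shows "norm (abs_L2 (\<lambda>s. h (rep_L2 X s))) \<le> norm X * K"
proof -
  let ?M = "lebesgue_on {-1..0::real}"
  have sq: "(\<lambda>s. h (rep_L2 X s)) square_integrable_on {-1..0}"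
    by (rule square_integrable_on_bounded_linear[OF h rep_L2_square_integrable])
  have "(norm (abs_L2 (\<lambda>s. h (rep_L2 X s))))\<^sup>2 \<le> (LINT s|?M. (norm (rep_L2 X s) * K)\<^sup>2)"
    unfolding norm_abs_L2[OF sq]
  proof (rule integral_mono)
    show "(norm (h (rep_L2 X s)))\<^sup>2 \<le> (norm (rep_L2 X s) * K)\<^sup>2" for s
      by (intro power_mono K) simp
  qed (use sq rep_L2_square_integrable[of X] in
      \<open>auto simp: square_integrable_on_def power_mult_distrib\<close>)
  also have "\<dots> = (norm X * K)\<^sup>2"
    by (simp add: power_mult_distrib norm_L2_rep)
  finally show ?thesis by (rule power2_le_imp_le) (use \<open>0 \<le> K\<close> in simp)
qed

lemma abs_L2_comp_rep_abs:
  fixes h :: "'a::euclidean_space \<Rightarrow> 'b::euclidean_space"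
  assumes h: "bounded_linear h" and f: "f square_integrable_on {-1..0}"
  shows "abs_L2 (\<lambda>s. h (rep_L2 (abs_L2 f) s)) = abs_L2 (\<lambda>s. h (f s))"
proof (rule abs_L2_cong)
  show "AE s in lebesgue_on {-1..0}. h (rep_L2 (abs_L2 f) s) = h (f s)"
    using rep_abs_L2[OF f] by eventually_elim simp
qed (intro square_integrable_on_bounded_linear[OF h] rep_L2_square_integrable f)+

lemma bounded_linear_abs_L2_comp:
  fixes h :: "'a::euclidean_space \<Rightarrow> 'b::euclidean_space"
  assumes h: "bounded_linear h"
  shows "bounded_linear (\<lambda>X. abs_L2 (\<lambda>s. h (rep_L2 X s)))"
proof -
  interpret h: bounded_linear h by (rule h)
  note rep = rep_L2_square_integrable
  note sq = square_integrable_on_bounded_linear[OF h rep]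
  obtain K where K: "\<And>v. norm (h v) \<le> norm v * K" "0 \<le> K" using h.nonneg_bounded by blast
  show ?thesis
  proof (rule bounded_linear_intro)
    fix X Y :: "'a L2" and c :: real
    show "abs_L2 (\<lambda>s. h (rep_L2 (X + Y) s))
        = abs_L2 (\<lambda>s. h (rep_L2 X s)) + abs_L2 (\<lambda>s. h (rep_L2 Y s))"
      unfolding plus_L2_eq_abs[of X Y] abs_L2_comp_rep_abs[OF h square_integrable_on_add[OF rep rep]]
        h.add by (rule abs_L2_add[OF sq sq])
    show "abs_L2 (\<lambda>s. h (rep_L2 (c *\<^sub>R X) s)) = c *\<^sub>R abs_L2 (\<lambda>s. h (rep_L2 X s))"
      unfolding scaleR_L2_eq_abs[of c X] abs_L2_comp_rep_abs[OF h square_integrable_on_scaleR[OF rep]]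
        h.scaleR by (rule abs_L2_scaleR[OF sq])
    show "norm (abs_L2 (\<lambda>s. h (rep_L2 X s))) \<le> norm X * K"
      by (rule norm_abs_L2_comp_le[OF h K])
  qed
qed

text \<open>
  Evaluated at a fixed \<open>s\<close>, the second component of \<open>T_op z\<close> is a finite-dimensional vector that
  is linear in \<open>z\<close> and bounded uniformly in \<open>s\<close>, because the integral over \<open>{s..0}\<close> is at
  most the \<open>L\<^sub>2\<close> norm.
\<close>

lemma bounded_linear_T_op: "bounded_linear (T_op :: ('m::finite, 'k::finite \<times> 'm) RL2 \<Rightarrow> _)"
proof -
  define G :: "('m, 'k \<times> 'm) RL2 \<Rightarrow> real \<Rightarrow> real^('k \<times> 'm)" where
    "G z s = stack (\<lambda>i. fst z - (LINT \<theta>|lebesgue_on {s..0}. block i (rep_L2 (snd z) \<theta>)))" for z s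
  have int: "bounded_linear (\<lambda>X::(real^('k \<times> 'm)) L2. LINT \<theta>|lebesgue_on {s..0}. block i (rep_L2 X \<theta>))"
    if "-1 \<le> s" for s and i :: 'k
    by (rule bounded_linear_LINT_rep_L2[OF bounded_linear_block that]) simp
  have sq: "G z square_integrable_on {-1..0}" for z
    unfolding G_def by (rule T_op_square_integrable)
  have lin: "G (z + w) s = G z s + G w s" "G (c *\<^sub>R z) s = c *\<^sub>R G z s" if "-1 \<le> s" for z w s c
    unfolding G_def
    by (simp_all add: stack_add[symmetric] stack_scaleR[symmetric] algebra_simps
        linear_add[OF bounded_linear.linear[OF int[OF that]]]
        linear_scale[OF bounded_linear.linear[OF int[OF that]]])
  have bound: "norm (G z s) \<le> norm z * (2 * real CARD('k))" if "-1 \<le> s" for z s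
  proof -
    have "norm (G z s) \<le> (\<Sum>i\<in>(UNIV::'k set). norm (fst z - (LINT \<theta>|lebesgue_on {s..0}. block i (rep_L2 (snd z) \<theta>))))"
      unfolding G_def by (rule norm_stack_le)
    also have "\<dots> \<le> (\<Sum>i\<in>(UNIV::'k set). norm z + norm z)"
    proof (rule sum_mono)
      fix i :: 'k
      have "norm (LINT \<theta>|lebesgue_on {s..0}. block i (rep_L2 (snd z) \<theta>)) \<le> norm (snd z) * 1"
        by (rule norm_LINT_rep_L2_le[OF bounded_linear_block that]) (simp_all add: norm_block_le)
      then show "norm (fst z - (LINT \<theta>|lebesgue_on {s..0}. block i (rep_L2 (snd z) \<theta>))) \<le> norm z + norm z"
        using norm_fst_le[of "fst z" "snd z"] norm_snd_le[of "snd z" "fst z"] 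
        by (intro order_trans[OF norm_triangle_ineq4] add_mono) auto
    qed
    finally show ?thesis by (simp add: mult_ac)
  qed
  have "bounded_linear (\<lambda>z. abs_L2 (G z))"
  proof (rule bounded_linear_intro)
    fix z w :: "('m, 'k \<times> 'm) RL2" and c :: real
    show "abs_L2 (G (z + w)) = abs_L2 (G z) + abs_L2 (G w)"
      unfolding abs_L2_add[OF sq sq, symmetric]
      by (rule abs_L2_cong) (auto intro!: sq square_integrable_on_add AE_I2 lin)
    show "abs_L2 (G (c *\<^sub>R z)) = c *\<^sub>R abs_L2 (G z)"
      unfolding abs_L2_scaleR[OF sq, symmetric]
      by (rule abs_L2_cong) (auto intro!: sq square_integrable_on_scaleR AE_I2 lin)
    show "norm (abs_L2 (G z)) \<le> norm z * (2 * real CARD('k))"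
      by (rule norm_abs_L2_le[OF sq]) (simp add: bound)
  qed
  then have "bounded_linear (\<lambda>z. (fst z, abs_L2 (G z)))"
    by (intro bounded_linear_Pair bounded_linear_fst)
  moreover have "T_op = (\<lambda>z. (fst z, abs_L2 (G z)))"
    unfolding G_def[abs_def] by (auto simp: T_op_def)
  ultimately show ?thesis by simp
qed

lemma bounded_linear_delay_LINT:
  fixes D :: "real^'m^'p"
  shows "bounded_linear (\<lambda>z :: ('m::finite, 'k::finite \<times> 'm) RL2.
    LINT \<theta>|lebesgue_on {-1..0}. D *v block i (rep_L2 (snd z) \<theta>))"
  by (rule bounded_linear_compose[OF bounded_linear_LINT_rep_L2 bounded_linear_snd])
    (auto intro: bounded_linear_compose[OF matrix_vector_mul_bounded_linear bounded_linear_block])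

lemma bounded_linear_C_op: "bounded_linear (C_op C Cd)"
proof -
  have "C_op C Cd = (\<lambda>z. (C + (\<Sum>i\<in>UNIV. Cd i)) *v fst z
      - (\<Sum>i\<in>UNIV. LINT \<theta>|lebesgue_on {-1..0}. Cd i *v block i (rep_L2 (snd z) \<theta>)))"
    by (auto simp: C_op_def split_beta fun_eq_iff)
  moreover have "bounded_linear \<dots>"
    by (intro bounded_linear_sub bounded_linear_sum bounded_linear_delay_LINT
        bounded_linear_compose[OF matrix_vector_mul_bounded_linear bounded_linear_fst])
  ultimately show ?thesis by simp
qed

lemma bounded_linear_scale_blocks:
  "bounded_linear (\<lambda>v :: real^('k::finite \<times> 'm::finite). stack (\<lambda>i. c i *\<^sub>R block i v))"
  unfolding linear_conv_bounded_linear[symmetric]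
  by (rule linearI) (auto simp: block_def stack_def vec_eq_iff algebra_simps)

lemma A_op_eq_C_op:
  "A_op A Ad \<tau> z =
    (C_op A Ad z, abs_L2 (\<lambda>s. stack (\<lambda>i. inverse (\<tau> i) *\<^sub>R block i (rep_L2 (snd z) s))))"
  by (auto simp: A_op_def C_op_def split_beta)

lemma bounded_linear_A_op: "bounded_linear (A_op A Ad \<tau>)"
proof -
  have "bounded_linear (\<lambda>z. (C_op A Ad z,
      abs_L2 (\<lambda>s. stack (\<lambda>i. inverse (\<tau> i) *\<^sub>R block i (rep_L2 (snd z) s)))))"
    by (intro bounded_linear_Pair bounded_linear_C_op bounded_linear_snd
        bounded_linear_compose[OF bounded_linear_abs_L2_comp[OF bounded_linear_scale_blocks]])
  then show ?thesis by (simp add: A_op_eq_C_op[abs_def])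
qed

lemma bounded_linear_B_op: "bounded_linear (B_op B)"
  unfolding B_op_def by (intro bounded_linear_Pair matrix_vector_mul_bounded_linear bounded_linear_zero)

lemma bounded_linear_Phi_op:
  assumes "bounded_linear \<K>" "bounded_linear \<P>" "bounded_linear \<T>" "bounded_linear \<A>"
    "bounded_linear \<B>" "bounded_linear \<C>"
  shows "bounded_linear (Phi_op F \<epsilon> Z \<K> \<P> \<T> \<A> \<B> \<C> \<alpha>)"
proof -
  note comp = bounded_linear_compose
  note mat = bounded_linear_compose[OF matrix_vector_mul_bounded_linear]
  note scale = bounded_linear_compose[OF bounded_linear_scaleR_right]
  show ?thesis
    unfolding Phi_op_def split_beta
    by (intro bounded_linear_Pair bounded_linear_add bounded_linear_sub bounded_linear_minus
        mat scale bounded_linear_fst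
        comp[OF bounded_linear_adjoint[OF assms(3)]] comp[OF bounded_linear_adjoint[OF assms(5)]]
        comp[OF assms(1)] comp[OF assms(2)] comp[OF assms(3)] comp[OF assms(4)] 
        comp[OF assms(5)] comp[OF assms(6)] bounded_linear_snd)
qed

text \<open>
  \<open>G\<close> and its adjoint have the same quadratic form.
\<close>

lemma op_nonpos_symmetrization:
  fixes G :: "'a::{real_inner, complete_space} \<Rightarrow> 'a"
  assumes "bounded_linear G" and "op_nonpos (\<lambda>w. G w + adjoint G w)"
  shows "w \<bullet> G w \<le> 0"
proof -
  have "0 \<le> w \<bullet> - (G w + adjoint G w)"
    using assms(2) by (simp add: op_nonpos_def op_nonneg_def)
  also have "\<dots> = - 2 * (w \<bullet> G w)"
    by (simp add: inner_simps inner_adjoint[OF assms(1)] inner_commute)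
  finally show ?thesis by simp
qed

section \<open>Histories of continuously differentiable functions\<close>

text \<open>
  The segment of \<open>f\<close> over each delay interval \<open>[t - \<tau> i, t]\<close>, rescaled to \<open>[-1, 0]\<close> so that all
  delays share one function space.
\<close>

definition history :: "('k \<Rightarrow> real) \<Rightarrow> (real \<Rightarrow> real^'m) \<Rightarrow> real \<Rightarrow> (real^('k::finite \<times> 'm::finite)) L2"
  where "history \<tau> f t = abs_L2 (\<lambda>s. stack (\<lambda>i. f (t + \<tau> i * s)))"

lemma square_integrable_on_history:
  fixes c :: "'k::finite \<Rightarrow> real"
  assumes "continuous_on UNIV f"
  shows "(\<lambda>s. stack (\<lambda>i. c i *\<^sub>R f (t + \<tau> i * s))) square_integrable_on {-1..0}"
proof (rule square_integrable_on_continuous)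
  have "continuous_on {-1..0} (\<lambda>s. f (t + \<tau> i * s))" for i
    by (rule continuous_on_compose2[OF assms]) (auto intro!: continuous_intros)
  then show "continuous_on {-1..0} (\<lambda>s. stack (\<lambda>i. c i *\<^sub>R f (t + \<tau> i * s)))"
    unfolding stack_def by (intro continuous_intros)
qed

lemmas square_integrable_on_history1 = square_integrable_on_history[where c = "\<lambda>_. 1", simplified]

lemma norm_history_le:
  fixes \<tau> :: "'k::finite \<Rightarrow> real"
  assumes "continuous_on UNIV f" and "\<And>i s. s \<in> {-1..0} \<Longrightarrow> norm (f (t + \<tau> i * s)) \<le> S"
  shows "norm (history \<tau> f t) \<le> real CARD('k) * S"
  unfolding history_def
proof (rule norm_abs_L2_le[OF square_integrable_on_history1[OF assms(1)]])
  fix s :: real assume "s \<in> {-1..0}"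
  then have "(\<Sum>i\<in>(UNIV::'k set). norm (f (t + \<tau> i * s))) \<le> (\<Sum>i\<in>(UNIV::'k set). S)"
    by (intro sum_mono assms)
  then show "norm (stack (\<lambda>i. f (t + \<tau> i * s))) \<le> real CARD('k) * S"
    using order_trans[OF norm_stack_le] by simp
qed

text \<open>
  The difference quotients of \<open>x\<close> converge to \<open>x'\<close> uniformly on compact intervals, because \<open>x'\<close>
  is uniformly continuous there; this controls the supremum norm of a history, hence its \<open>L\<^sub>2\<close> norm.
\<close>

lemma has_vector_derivative_history:
  fixes \<tau> :: "'k::finite \<Rightarrow> real"
  assumes x: "\<And>t. (x has_vector_derivative x' t) (at t)" and x': "continuous_on UNIV x'"
    and \<tau>: "\<And>i. 0 < \<tau> i"
  shows "(history \<tau> x has_vector_derivative history \<tau> x' t) (at t)"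
  unfolding has_vector_derivative_def has_derivative_at_alt
proof (intro conjI allI impI)
  show "bounded_linear (\<lambda>h. h *\<^sub>R history \<tau> x' t)"
    by (rule bounded_linear_scaleR_left)
  fix e :: real assume e: "0 < e"
  define T where "T = Max (range \<tau>)"
  have T: "\<tau> i \<le> T" for i by (simp add: T_def)
  have xc: "continuous_on UNIV x"
    using x by (auto intro!: continuous_at_imp_continuous_on has_vector_derivative_continuous)
  have "uniformly_continuous_on {t - T - 1..t + 1} x'"
    by (rule compact_uniformly_continuous[OF continuous_on_subset[OF x']]) auto
  then obtain d where d: "d > 0" "\<And>r s. r \<in> {t - T - 1..t + 1} \<Longrightarrow> s \<in> {t - T - 1..t + 1} \<Longrightarrow>
      dist s r < d \<Longrightarrow> dist (x' s) (x' r) < e / real CARD('k)"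
    unfolding uniformly_continuous_on_def using e by (metis divide_pos_pos of_nat_0_less_iff zero_less_card_finite)
  have "norm (history \<tau> x y - history \<tau> x t - (y - t) *\<^sub>R history \<tau> x' t) \<le> e * norm (y - t)"
    if y: "norm (y - t) < min d 1" for y
  proof -
    let ?g = "\<lambda>i s. x (y + \<tau> i * s) - x (t + \<tau> i * s) - (y - t) *\<^sub>R x' (t + \<tau> i * s)"
    have g: "norm (?g i s) \<le> norm (y - t) * (e / real CARD('k))" if s: "s \<in> {-1..0}" for i s
    proof -
      have ts: "0 \<le> - (\<tau> i * s)" "- (\<tau> i * s) \<le> T" 
        using \<tau>[of i] T[of i] s mult_left_mono[of "-s" 1 "\<tau> i"] by (auto simp: mult_le_0_iff)
      let ?a = "t + \<tau> i * s" and ?b = "y + \<tau> i * s"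
      have "norm (x ?b - x ?a - (?b - ?a) *\<^sub>R x' ?a) \<le> norm (?b - ?a) * (e / real CARD('k))"
      proof (rule vector_differentiable_bound_linearization)
        show "(x has_vector_derivative x' r) (at r within closed_segment ?a ?b)" for r
          using x by (rule has_vector_derivative_at_within)
        fix r assume "r \<in> closed_segment ?a ?b"
        then have "\<bar>r - ?a\<bar> \<le> \<bar>y - t\<bar>" by (auto simp: closed_segment_eq_real_ivl split: if_splits)
        then have "dist (x' r) (x' ?a) < e / real CARD('k)"
          using y ts by (intro d(2)) (auto simp: dist_real_def)
        then show "norm (x' r - x' ?a) \<le> e / real CARD('k)" by (simp add: dist_norm)
      qed auto
      then show ?thesis by simp
    qed
    note sq = square_integrable_on_history1[OF xc] square_integrable_on_history1[OF x']
    have "history \<tau> x y - history \<tau> x t - (y - t) *\<^sub>R history \<tau> x' t = abs_L2 (\<lambda>s. stack (\<lambda>i. ?g i s))"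
      unfolding history_def stack_diff stack_scaleR
      by (simp add: abs_L2_diff abs_L2_scaleR sq square_integrable_on_diff square_integrable_on_scaleR)
    also have "norm \<dots> \<le> e * norm (y - t)"
    proof (rule norm_abs_L2_le)
      show "(\<lambda>s. stack (\<lambda>i. ?g i s)) square_integrable_on {-1..0}"
        unfolding stack_diff stack_scaleR
        by (intro sq square_integrable_on_diff square_integrable_on_scaleR)
      fix s :: real assume "s \<in> {-1..0}"
      then have "(\<Sum>i\<in>(UNIV::'k set). norm (?g i s)) \<le> (\<Sum>i\<in>(UNIV::'k set). norm (y - t) * (e / real CARD('k)))"
        by (intro sum_mono g)
      then show "norm (stack (\<lambda>i. ?g i s)) \<le> e * norm (y - t)"
        using order_trans[OF norm_stack_le] by (simp add: mult_ac)
    qed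
    finally show ?thesis .
  qed
  then show "\<exists>d>0. \<forall>y. norm (y - t) < d \<longrightarrow>
      norm (history \<tau> x y - history \<tau> x t - (y - t) *\<^sub>R history \<tau> x' t) \<le> e * norm (y - t)"
    using d(1) by (intro exI[of _ "min d 1"]) auto
qed

lemma sum_matrix_vector_mult:
  fixes M :: "'i \<Rightarrow> real^'n^'m"
  shows "(\<Sum>i\<in>S. M i) *v v = (\<Sum>i\<in>S. M i *v v)"
  by (induction S rule: infinite_finite_induct) (simp_all add: matrix_vector_mult_add_rdistrib)

section \<open>The operators on the state of a continuously differentiable function\<close>

text \<open>
  The state of the partial integral equation is the current value together with the derivative,
  with respect to \<open>s\<close>, of the rescaled history; \<open>T_op\<close> integrates that derivative back.
\<close>

definition pie_state ::
    "('k \<Rightarrow> real) \<Rightarrow> (real \<Rightarrow> real^'m) \<Rightarrow> (real \<Rightarrow> real^'m) \<Rightarrow> real \<Rightarrow> ('m::finite, 'k::finite \<times> 'm) RL2"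
  where "pie_state \<tau> x x' t = (x t, abs_L2 (\<lambda>s. stack (\<lambda>i. \<tau> i *\<^sub>R x' (t + \<tau> i * s))))"

context
  fixes \<tau> :: "'k::finite \<Rightarrow> real" and x x' :: "real \<Rightarrow> real^'m::finite"
  assumes x: "\<And>t. (x has_vector_derivative x' t) (at t)" and x': "continuous_on UNIV x'"
    and \<tau>: "\<And>i. 0 < \<tau> i"
begin

lemma continuous_on_x: "continuous_on UNIV x"
  using x by (auto intro!: continuous_at_imp_continuous_on has_vector_derivative_continuous)

text \<open>
  The fundamental theorem of calculus.  The linear map \<open>h\<close> serves two purposes: the identity gives
  \<open>T_op\<close>, the matrices of the delayed terms give \<open>A_op\<close> and \<open>C_op\<close>.
\<close>

lemma LINT_pie_state:
  fixes h :: "real^'m \<Rightarrow> 'b::euclidean_space"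
  assumes h: "bounded_linear h" and s: "-1 \<le> s" "s \<le> 0"
  shows "(LINT \<theta>|lebesgue_on {s..0}. h (block i (rep_L2 (snd (pie_state \<tau> x x' t)) \<theta>)))
    = h (x t) - h (x (t + \<tau> i * s))"
proof -
  have hb: "bounded_linear (\<lambda>v. h (block i v))"
    by (rule bounded_linear_compose[OF h bounded_linear_block])
  have "((\<lambda>\<theta>. h (\<tau> i *\<^sub>R x' (t + \<tau> i * \<theta>))) has_integral h (x (t + \<tau> i * 0)) - h (x (t + \<tau> i * s))) {s..0}"
  proof (rule fundamental_theorem_of_calculus[OF s(2)])
    fix \<theta> :: real
    have "((\<lambda>\<theta>. x (t + \<tau> i * \<theta>)) has_vector_derivative \<tau> i *\<^sub>R x' (t + \<tau> i * \<theta>)) (at \<theta> within {s..0})"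
      by (rule vector_diff_chain_within[where g = x, unfolded o_def, OF _ has_vector_derivative_at_within[OF x]])
        (auto intro!: derivative_eq_intros)
    then show "((\<lambda>\<theta>. h (x (t + \<tau> i * \<theta>))) has_vector_derivative h (\<tau> i *\<^sub>R x' (t + \<tau> i * \<theta>))) (at \<theta> within {s..0})"
      by (rule bounded_linear.has_vector_derivative[OF h])
  qed
  moreover have "integrable (lebesgue_on {s..0}) (\<lambda>\<theta>. h (\<tau> i *\<^sub>R x' (t + \<tau> i * \<theta>)))"
    using integrable_bounded_linear_subinterval[OF hb s(1) order_refl square_integrable_on_history[OF x', of \<tau>]]
    by simp
  ultimately show ?thesis
    unfolding pie_state_def snd_conv LINT_rep_abs_L2[OF hb s(1) order_refl square_integrable_on_history[OF x']]
    by (simp add: lebesgue_integral_eq_integral integral_unique)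
qed

lemma T_op_pie_state: "T_op (pie_state \<tau> x x' t) = (x t, history \<tau> x t)"
proof -
  let ?X = "snd (pie_state \<tau> x x' t)"
  have "abs_L2 (\<lambda>s. stack (\<lambda>i. x t - (LINT \<theta>|lebesgue_on {s..0}. block i (rep_L2 ?X \<theta>)))) = history \<tau> x t"
    unfolding history_def
  proof (rule abs_L2_cong[OF T_op_square_integrable square_integrable_on_history1[OF continuous_on_x]])
    show "AE s in lebesgue_on {-1..0}. stack (\<lambda>i. x t - (LINT \<theta>|lebesgue_on {s..0}. block i (rep_L2 ?X \<theta>)))
        = stack (\<lambda>i. x (t + \<tau> i * s))"
      by (rule AE_I2) (simp add: LINT_pie_state[OF bounded_linear_ident])
  qed
  then show ?thesis by (simp add: T_op_def pie_state_def)
qed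

lemma C_op_pie_state:
  "C_op C Cd (pie_state \<tau> x x' t) = C *v x t + (\<Sum>i\<in>UNIV. Cd i *v x (t - \<tau> i))"
proof -
  have "(LINT \<theta>|lebesgue_on {-1..0}. Cd i *v block i (rep_L2 (snd (pie_state \<tau> x x' t)) \<theta>))
      = Cd i *v x t - Cd i *v x (t - \<tau> i)" for i
    using LINT_pie_state[OF matrix_vector_mul_bounded_linear[of "Cd i"], of "-1" i t] by simp
  then show ?thesis
    by (simp add: C_op_def pie_state_def matrix_vector_mult_add_rdistrib sum_subtractf
        sum_matrix_vector_mult)
qed

lemma A_op_pie_state:
  "A_op A Ad \<tau> (pie_state \<tau> x x' t) = (A *v x t + (\<Sum>i\<in>UNIV. Ad i *v x (t - \<tau> i)), history \<tau> x' t)"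
proof -
  have "abs_L2 (\<lambda>s. stack (\<lambda>i. inverse (\<tau> i) *\<^sub>R block i (rep_L2 (snd (pie_state \<tau> x x' t)) s)))
      = history \<tau> x' t"
    unfolding pie_state_def snd_conv history_def
      abs_L2_comp_rep_abs[OF bounded_linear_scale_blocks square_integrable_on_history[OF x']]
    using \<tau> by (simp add: less_imp_neq[symmetric])
  then show ?thesis by (simp add: A_op_eq_C_op C_op_pie_state)
qed

end

section \<open>Dissipation and exponential decay\<close>

lemma self_adjoint_inner:
  fixes P :: "'a::{real_inner, complete_space} \<Rightarrow> 'a"
  assumes "bounded_linear P" "P = adjoint P"
  shows "P x \<bullet> y = x \<bullet> P y"
  using inner_adjoint[OF assms(1)] assms(2) by metis

text \<open>
  The choice of the vector \<open>(u - \<K> z, z)\<close> confines the auxiliary feedback \<open>\<K>\<close> to a square.  In the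
  first component the terms with \<open>F\<close> and \<open>Z\<close> combine to \<open>Z *v \<C> z - F *v u = 0\<close>; the term with
  \<open>adjoint \<B>\<close> contributes \<open>\<B> (u - \<K> z)\<close>, which replaces the auxiliary input \<open>\<K> z\<close> of the second
  component by the actual input \<open>u\<close>.
\<close>

lemma Phi_op_quadratic_form:
  fixes \<K> :: "('m::finite, 'k::finite \<times> 'm) RL2 \<Rightarrow> real^'u"
    and \<T> \<P> :: "('m, 'k \<times> 'm) RL2 \<Rightarrow> ('m, 'k \<times> 'm) RL2"
  assumes \<T>: "bounded_linear \<T>" and \<B>: "bounded_linear \<B>" and \<P>: "bounded_linear \<P>" "\<P> = adjoint \<P>"
    and u: "F *v u = Z *v \<C> z"
  shows "(u - \<K> z, z) \<bullet> Phi_op F \<epsilon> Z \<K> \<P> \<T> \<A> \<B> \<C> \<alpha> (u - \<K> z, z)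
    = \<epsilon> / 2 * (norm (u - \<K> z))\<^sup>2 + \<T> z \<bullet> \<P> (\<A> z + \<B> u) + \<alpha> * (\<T> z \<bullet> \<P> (\<T> z))"
proof -
  let ?v = "u - \<K> z"
  have v: "\<B> ?v \<bullet> \<P> (\<T> z) = \<T> z \<bullet> \<P> (\<B> u) - \<T> z \<bullet> \<P> (\<B> (\<K> z))"
    using self_adjoint_inner[OF \<P>, of "\<B> ?v" "\<T> z"] 
    by (simp add: linear_diff[OF bounded_linear.linear[OF \<B>]] linear_diff[OF bounded_linear.linear[OF \<P>(1)]] inner_commute inner_simps)
  have Fv: "F *v ?v + F *v \<K> z = Z *v \<C> z"
    by (simp add: u matrix_vector_mult_diff_distrib)
  have "?v \<bullet> (F *v ?v) + ?v \<bullet> (F *v \<K> z) = ?v \<bullet> (Z *v \<C> z)"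
    unfolding Fv[symmetric] by (simp add: inner_add_right)
  then show ?thesis
    by (simp add: Phi_op_def inner_adjoint[OF \<T>] inner_adjoint[OF \<B>] v
        inner_add_right inner_diff_right inner_minus_right power2_norm_eq_inner
        linear_add[OF bounded_linear.linear[OF \<P>(1)]] linear_scale[OF bounded_linear.linear[OF \<P>(1)]])
qed

text \<open>
  Testing with \<open>(v, 0)\<close> gives \<open>\<epsilon> / 2 * (v \<bullet> v) \<le> v \<bullet> (F *v v)\<close>, so \<open>F\<close> is injective.
\<close>

lemma Phi_op_nonpos_imp_invertible:
  fixes F :: "real^'u^'u"
  assumes nonpos: "\<And>w. w \<bullet> Phi_op F \<epsilon> Z \<K> \<P> \<T> \<A> \<B> \<C> \<alpha> w \<le> 0"
    and lin: "linear \<K>" "linear \<P>" "linear \<T>" "linear \<C>" "bounded_linear \<B>" and \<epsilon>: "0 < \<epsilon>"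
  shows "invertible F"
proof -
  have "v = 0" if "F *v v = 0" for v
  proof -
    have "adjoint \<B> 0 = 0"
      by (rule linear_0[OF bounded_linear.linear[OF bounded_linear_adjoint[OF lin(5)]]])
    then have "\<epsilon> / 2 * (v \<bullet> v) \<le> 0"
      using nonpos[of "(v, 0)"] that lin by (simp add: Phi_op_def inner_prod_def linear_0)
    then have "v \<bullet> v = 0" using \<epsilon> inner_ge_zero[of v] by (auto simp: mult_le_0_iff)
    then show ?thesis by simp
  qed
  then show ?thesis
    by (simp add: invertible_left_inverse matrix_left_invertible_ker)
qed

text \<open>
  The Lyapunov functional \<open>W \<bullet> P W\<close> has derivative \<open>2 * (W \<bullet> P W')\<close> since \<open>P\<close> is symmetric, so
  multiplied by \<open>exp (2 * \<alpha> * t)\<close> it is nonincreasing.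
\<close>

lemma dissipation_imp_decay:
  fixes W W' :: "real \<Rightarrow> 'a::real_inner"
  assumes W: "\<And>t. 0 \<le> t \<Longrightarrow> (W has_vector_derivative W' t) (at t)"
    and P: "bounded_linear P" "\<And>x y. P x \<bullet> y = x \<bullet> P y"
    and diss: "\<And>t. 0 \<le> t \<Longrightarrow> W t \<bullet> P (W' t) + \<alpha> * (W t \<bullet> P (W t)) \<le> 0"
    and t: "0 \<le> t"
  shows "W t \<bullet> P (W t) \<le> exp (- 2 * \<alpha> * t) * (W 0 \<bullet> P (W 0))"
proof -
  define E where "E s = exp (2 * \<alpha> * s) * (W s \<bullet> P (W s))" for s
  have "E t \<le> E 0"
  proof (rule DERIV_nonpos_imp_nonincreasing[OF t])
    fix s assume s: "0 \<le> s" "s \<le> t"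
    have "((\<lambda>s. W s \<bullet> P (W s)) has_vector_derivative W s \<bullet> P (W' s) + W' s \<bullet> P (W s)) (at s)"
      by (rule bounded_bilinear.has_vector_derivative[OF bounded_bilinear_inner W[OF s(1)]
          bounded_linear.has_vector_derivative[OF P(1) W[OF s(1)]]])
    then have V: "((\<lambda>s. W s \<bullet> P (W s)) has_real_derivative 2 * (W s \<bullet> P (W' s))) (at s)"
      using P(2)[of "W s" "W' s"] by (simp add: has_real_derivative_iff_has_vector_derivative inner_commute)
    have "(E has_real_derivative 
        2 * exp (2 * \<alpha> * s) * (W s \<bullet> P (W' s) + \<alpha> * (W s \<bullet> P (W s)))) (at s)"
      unfolding E_def by (rule derivative_eq_intros V refl | simp add: algebra_simps)+
    moreover have "2 * exp (2 * \<alpha> * s) * (W s \<bullet> P (W' s) + \<alpha> * (W s \<bullet> P (W s))) \<le> 0"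
      using diss[OF s(1)] by (simp add: mult_le_0_iff)
    ultimately show "\<exists>y. (E has_real_derivative y) (at s) \<and> y \<le> 0" by blast
  qed
  then have "exp (- 2 * \<alpha> * t) * E t \<le> exp (- 2 * \<alpha> * t) * E 0"
    by (intro mult_left_mono) auto
  then show ?thesis by (simp add: E_def mult.assoc[symmetric] exp_add[symmetric])
qed

lemma coercive_decay_bound:
  fixes W :: "'a::real_inner"
  assumes coer: "\<delta> * (W \<bullet> W) \<le> W \<bullet> P W" and \<delta>: "0 < \<delta>"
    and decay: "W \<bullet> P W \<le> exp (- 2 * \<alpha> * t) * (W0 \<bullet> P W0)"
    and \<kappa>: "norm (P W0) \<le> norm W0 * \<kappa>" "0 \<le> \<kappa>"
  shows "norm W \<le> sqrt (\<kappa> / \<delta>) * norm W0 * exp (- \<alpha> * t)"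
proof -
  have "W0 \<bullet> P W0 \<le> norm W0 * norm (P W0)" by (rule norm_cauchy_schwarz)
  also have "\<dots> \<le> norm W0 * (norm W0 * \<kappa>)" by (intro mult_left_mono \<kappa>) simp
  finally have "exp (- 2 * \<alpha> * t) * (W0 \<bullet> P W0) \<le> exp (- 2 * \<alpha> * t) * (norm W0 * (norm W0 * \<kappa>))"
    by (intro mult_left_mono) auto
  then have "\<delta> * (norm W)\<^sup>2 \<le> exp (- 2 * \<alpha> * t) * (norm W0 * (norm W0 * \<kappa>))"
    using order_trans[OF order_trans[OF coer decay]] by (simp only: power2_norm_eq_inner)
  then have "(norm W)\<^sup>2 \<le> \<kappa> / \<delta> * (norm W0)\<^sup>2 * exp (- 2 * \<alpha> * t)"
    using \<delta> by (simp add: field_simps power2_eq_square)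
  also have "\<dots> = (sqrt (\<kappa> / \<delta>) * norm W0 * exp (- \<alpha> * t))\<^sup>2"
    using \<delta> \<kappa>(2) by (simp add: power_mult_distrib exp_double[symmetric] mult_ac)
  finally show ?thesis
    by (rule power2_le_imp_le) (use \<delta> \<kappa>(2) in auto)
qed

section \<open>From continuously differentiable to continuous initial histories\<close>

text \<open>
  A solution of a linear delay equation with constant coefficients may be replaced by its averages
  \<open>x s = (1 / h) * \<integral>{s..s + h} p\<close>: they solve the same equation for nonnegative times, are
  continuously differentiable on the whole line even where \<open>p\<close> is only continuous, and converge to
  \<open>p\<close> uniformly on compact intervals as \<open>h\<close> tends to zero.  An estimate by the supremum over the
  initial interval therefore passes from the averages to \<open>p\<close>.
\<close>

lemma delay_bound_by_averaging:
  fixes p :: "real \<Rightarrow> real^'m" and D0 :: "real^'m^'m" and D :: "'k::finite \<Rightarrow> real^'m^'m"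
  assumes C1: "\<And>x x' S t. \<lbrakk>\<And>t. (x has_vector_derivative x' t) (at t); continuous_on UNIV x';
      \<And>t. 0 \<le> t \<Longrightarrow> x' t = D0 *v x t + (\<Sum>i\<in>UNIV. D i *v x (t - \<tau> i));
      \<And>s. s \<in> {-T..0} \<Longrightarrow> norm (x s) \<le> S; 0 \<le> t\<rbrakk> \<Longrightarrow> norm (x t) \<le> M * S * exp (- \<alpha> * t)"
    and p: "continuous_on UNIV p"
    and dde: "\<And>t. 0 \<le> t \<Longrightarrow> 
      (p has_vector_derivative D0 *v p t + (\<Sum>i\<in>UNIV. D i *v p (t - \<tau> i))) (at t within {0..})"
    and S: "\<And>s. s \<in> {-T..0} \<Longrightarrow> norm (p s) \<le> S" and T: "0 \<le> T" and M: "0 \<le> M" and t: "0 \<le> t"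
  shows "norm (p t) \<le> M * S * exp (- \<alpha> * t)"
proof (rule field_le_epsilon)
  fix e :: real assume e: "0 < e"
  obtain I where I: "\<And>s. (I has_vector_derivative p s) (at s)"
    using einterval_antiderivative[of "-\<infinity>" "\<infinity>" p] p 
    by (auto simp: continuous_on_eq_continuous_at)
  \<comment> \<open>The delay equation in integrated form: \<open>q\<close> is constant for nonnegative times.\<close>
  define q where "q s = p s - (D0 *v I s + (\<Sum>i\<in>UNIV. D i *v I (s - \<tau> i)))" for s
  have mat: "((\<lambda>s. H *v f s) has_vector_derivative H *v f') F" 
    if "(f has_vector_derivative f') F" for f f' F and H :: "real^'m^'m"
    by (rule bounded_linear.has_vector_derivative[OF matrix_vector_mul_bounded_linear that])
  have shift: "((\<lambda>s. I (s + c)) has_vector_derivative p (s + c)) (at s within X)" for s c X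
  proof -
    have "((\<lambda>s. s + c) has_vector_derivative 1) (at s within X)"
      by (auto intro!: derivative_eq_intros)
    from vector_diff_chain_within[OF this has_vector_derivative_at_within[OF I]] show ?thesis
      by (simp add: o_def)
  qed
  have "(q has_vector_derivative 0) (at s within {0..})" if "s \<in> {0..}" for s
  proof -
    have "(q has_vector_derivative (D0 *v p s + (\<Sum>i\<in>UNIV. D i *v p (s - \<tau> i)))
        - (D0 *v p s + (\<Sum>i\<in>UNIV. D i *v p (s - \<tau> i)))) (at s within {0..})"
      unfolding q_def using that
      by (intro has_vector_derivative_diff has_vector_derivative_add has_vector_derivative_sum mat dde
          has_vector_derivative_at_within[OF I]) (use shift[of "- \<tau> _"] in auto)
    then show ?thesis by simp
  qed
  then obtain c where c: "\<And>s. 0 \<le> s \<Longrightarrow> q s = c"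
    using has_vector_derivative_zero_constant[of "{0..}" q] by auto
  \<comment> \<open>An error \<open>\<eta>\<close> in the averages enters twice, through the initial supremum and at time \<open>t\<close>.\<close>
  define \<eta> where "\<eta> = e / (M * exp (- \<alpha> * t) + 1)"
  have "0 < M * exp (- \<alpha> * t) + 1"
    using M by (intro add_nonneg_pos mult_nonneg_nonneg) auto
  then have \<eta>: "0 < \<eta>" "\<eta> * (M * exp (- \<alpha> * t) + 1) = e"
    using e by (simp_all add: \<eta>_def)
  have "uniformly_continuous_on {-T..t + 1} p"
    by (rule compact_uniformly_continuous[OF continuous_on_subset[OF p]]) auto
  then obtain d where d: "d > 0" "\<And>r s. r \<in> {-T..t + 1} \<Longrightarrow> s \<in> {-T..t + 1} \<Longrightarrow>
      dist s r < d \<Longrightarrow> dist (p s) (p r) < \<eta>"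
    unfolding uniformly_continuous_on_def using \<eta>(1) by metis
  define h where "h = min (d / 2) 1"
  have h: "0 < h" "h < d" "h \<le> 1" using d(1) by (auto simp: h_def)
  define x where "x s = (1 / h) *\<^sub>R (I (s + h) - I s)" for s
  define x' where "x' s = (1 / h) *\<^sub>R (p (s + h) - p s)" for s
  have near: "norm (x s - p s) \<le> \<eta>" if s: "s \<in> {-T..t}" for s
  proof -
    have "norm (I (s + h) - I s - (s + h - s) *\<^sub>R p s) \<le> norm (s + h - s) * \<eta>"
    proof (rule vector_differentiable_bound_linearization)
      show "(I has_vector_derivative p r) (at r within closed_segment s (s + h))" for r
        using I by (rule has_vector_derivative_at_within)
      fix r assume "r \<in> closed_segment s (s + h)"
      then have "dist (p r) (p s) < \<eta>"
        using h s by (intro d(2)) (auto simp: dist_real_def closed_segment_eq_real_ivl split: if_splits)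
      then show "norm (p r - p s) \<le> \<eta>" by (simp add: dist_norm)
    qed auto
    then have "norm (I (s + h) - I s - h *\<^sub>R p s) / h \<le> \<eta>"
      using h(1) by (simp add: pos_divide_le_eq mult.commute)
    moreover have "x s - p s = (1 / h) *\<^sub>R (I (s + h) - I s - h *\<^sub>R p s)"
      using h(1) by (simp add: x_def algebra_simps)
    ultimately show ?thesis using h(1) by simp
  qed
  have "norm (x t) \<le> M * (S + \<eta>) * exp (- \<alpha> * t)"
  proof (rule C1[where x' = x', OF _ _ _ _ t])
    show "(x has_vector_derivative x' s) (at s)" for s
      unfolding x_def x'_def
      by (intro bounded_linear.has_vector_derivative[OF bounded_linear_scaleR_right]
          has_vector_derivative_diff shift I)
    show "continuous_on UNIV x'"
      unfolding x'_def
      by (intro continuous_intros p continuous_on_compose2[OF p]) auto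
    show "x' s = D0 *v x s + (\<Sum>i\<in>UNIV. D i *v x (s - \<tau> i))" if "0 \<le> s" for s
    proof -
      have "q (s + h) = q s" using c that h(1) by simp
      then have eq: "p (s + h) - p s = D0 *v (I (s + h) - I s)
          + (\<Sum>i\<in>UNIV. D i *v (I (s + h - \<tau> i) - I (s - \<tau> i)))"
        by (simp add: q_def matrix_vector_mult_diff_distrib sum_subtractf algebra_simps)
      have "x (s - \<tau> i) = (1 / h) *\<^sub>R (I (s + h - \<tau> i) - I (s - \<tau> i))" for i
        by (simp add: x_def algebra_simps)
      then show ?thesis
        unfolding x'_def eq x_def[of s]
        by (simp only: matrix_vector_mult_scaleR scaleR_sum_right scaleR_add_right)
    qed
    show "norm (x s) \<le> S + \<eta>" if "s \<in> {-T..0}" for s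
      using S[OF that] near[of s] that t norm_triangle_sub[of "x s" "p s"] by auto
  qed
  moreover have "norm (p t) \<le> norm (x t) + \<eta>"
    using near[of t] T t norm_triangle_sub[of "p t" "x t"] by (auto simp: norm_minus_commute)
  moreover have "M * (S + \<eta>) * exp (- \<alpha> * t) + \<eta> = M * S * exp (- \<alpha> * t) + \<eta> * (M * exp (- \<alpha> * t) + 1)"
    by (simp add: algebra_simps)
  ultimately show "norm (p t) \<le> M * S * exp (- \<alpha> * t) + e"
    unfolding \<eta>(2) by linarith
qed

section \<open>Exponential stability of the closed loop\<close>

lemma continuous_on_concat_solution:
  fixes x :: "real \<Rightarrow> 'a::real_normed_vector"
  assumes x0: "continuous_on {-T..0} x0" and eq: "\<And>t. t \<in> {-T..0} \<Longrightarrow> x t = x0 t"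
    and x: "\<And>t. 0 \<le> t \<Longrightarrow> (x has_vector_derivative x' t) (at t within {0..})" and T: "0 \<le> T"
  shows "continuous_on UNIV (\<lambda>t. x (max (-T) t))"
proof -
  have "continuous_on {-T..0} x"
    using x0 eq by (subst continuous_on_cong[OF refl]) auto
  moreover have "continuous_on {0..} x"
    using x by (auto simp: continuous_on_eq_continuous_within intro: has_vector_derivative_continuous)
  moreover have "{-T..} = {-T..0} \<union> {0..}" using T by auto
  ultimately have "continuous_on {-T..} x"
    by (simp add: continuous_on_closed_Un)
  then show ?thesis
    by (rule continuous_on_compose2) (auto intro!: continuous_intros)
qed

text \<open>
  Substituting the output feedback turns the closed loop into a plain delay equation with one matrix
  per delay, as the averaging argument requires.
\<close>

lemma closed_loop_matrices:
  fixes A :: "real^'m^'m" and B :: "real^'u^'m" and C :: "real^'m^'y" and L :: "real^'y^'u"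
  shows "A *v p + (\<Sum>i\<in>I. Ad i *v q i) + B *v (L *v (C *v p + (\<Sum>i\<in>I. Cd i *v q i)))
    = (A + B ** L ** C) *v p + (\<Sum>i\<in>I. (Ad i + B ** L ** Cd i) *v q i)"
  by (simp add: matrix_vector_mult_add_rdistrib matrix_vector_right_distrib sum.distrib
      matrix_vector_mul_assoc[symmetric] linear_sum[OF matrix_vector_mul_linear] algebra_simps)

theorem corollary12:
  fixes A :: "real^'m^'m" and Ad :: "'k::{finite,linorder} \<Rightarrow> real^'m^'m"
    and B :: "real^'u^'m"
    and C :: "real^'m^'y" and Cd :: "'k \<Rightarrow> real^'m^'y"
    and \<tau> :: "'k \<Rightarrow> real" and \<alpha> :: real and L :: "real^'y^'u"
    and \<K> :: "('m, 'k \<times> 'm) RL2 \<Rightarrow> real^'u"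
    and \<P> :: "('m, 'k \<times> 'm) RL2 \<Rightarrow> ('m, 'k \<times> 'm) RL2"
    and F :: "real^'u^'u" and Z :: "real^'y^'u" and \<delta> \<epsilon> :: real
  defines "\<Phi> \<equiv> Phi_op F \<epsilon> Z \<K> \<P> T_op (A_op A Ad \<tau>) (B_op B) (C_op C Cd) \<alpha>"
  assumes "\<And>i. 0 < \<tau> i" and "strict_mono \<tau>"
    and "\<alpha> > 0"
    and "\<K> \<in> fourPI_fin"
    and "\<P> \<in> fourPI" and "\<P> = adjoint \<P>"
    and "\<delta> > 0" and "\<epsilon> > 0"
    and "op_nonneg (\<lambda>z. \<P> z - \<delta> *\<^sub>R z)"
    and "op_nonpos (\<lambda>w. \<Phi> w + adjoint \<Phi> w)"
    and "L = matrix_inv F ** Z"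
  shows "\<exists>M>0. \<forall>x0 \<in> sobolev (- Max (range \<tau>)) 0.
    \<forall>(x :: real \<Rightarrow> real^'m) (u :: real \<Rightarrow> real^'u) (y :: real \<Rightarrow> real^'y).
      (\<forall>t\<ge>0. (x has_vector_derivative
                (A *v x t + (\<Sum>i\<in>UNIV. Ad i *v x (t - \<tau> i)) + B *v u t)) (at t within {0..})) \<and>
      (\<forall>t\<ge>0. y t = C *v x t + (\<Sum>i\<in>UNIV. Cd i *v x (t - \<tau> i))) \<and>
      (\<forall>t\<ge>0. u t = L *v y t) \<and>
      (\<forall>t\<in>{- Max (range \<tau>)..0}. x t = x0 t)
      \<longrightarrow> (\<forall>t\<ge>0. norm (x t)
            \<le> M * (SUP t\<in>{- Max (range \<tau>)..0}. norm (x0 t)) * exp (- \<alpha> * t))"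
proof -
  have lin_P: "bounded_linear \<P>" and lin_K: "bounded_linear \<K>"
    using \<open>\<P> \<in> fourPI\<close> \<open>\<K> \<in> fourPI_fin\<close> by (simp_all add: fourPI_def fourPI_fin_def)
  note lins = lin_K lin_P bounded_linear_T_op bounded_linear_A_op bounded_linear_B_op bounded_linear_C_op
  have P_self: "\<P> z \<bullet> z' = z \<bullet> \<P> z'" for z z'
    by (rule self_adjoint_inner[OF lin_P \<open>\<P> = adjoint \<P>\<close>])
  have \<Phi>_nonpos: "w \<bullet> Phi_op F \<epsilon> Z \<K> \<P> T_op (A_op A Ad \<tau>) (B_op B) (C_op C Cd) \<alpha> w \<le> 0" for w
    using \<open>op_nonpos (\<lambda>w. \<Phi> w + adjoint \<Phi> w)\<close> unfolding \<Phi>_def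
    by (rule op_nonpos_symmetrization[OF bounded_linear_Phi_op[OF lins]])
  have "invertible F"
    by (rule Phi_op_nonpos_imp_invertible[OF \<Phi>_nonpos])
      (intro lins lins[THEN bounded_linear.linear] \<open>\<epsilon> > 0\<close>)+
  then have "F ** matrix_inv F = mat 1"
    unfolding matrix_inv_def invertible_def by (rule someI2_ex) simp
  then have FL: "F *v (L *v w) = Z *v w" for w
    by (simp add: \<open>L = matrix_inv F ** Z\<close> matrix_vector_mul_assoc matrix_mul_assoc)
  have coercive: "\<delta> * (z \<bullet> z) \<le> z \<bullet> \<P> z" for z
    using \<open>op_nonneg (\<lambda>z. \<P> z - \<delta> *\<^sub>R z)\<close> 
    unfolding op_nonneg_def inner_diff_right inner_scaleR_right by (meson diff_ge_0_iff_ge)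
  obtain \<kappa> where \<kappa>: "\<And>z. norm (\<P> z) \<le> norm z * \<kappa>" "0 \<le> \<kappa>"
    using bounded_linear.nonneg_bounded[OF lin_P] by blast
  define T where "T = Max (range \<tau>)"
  have \<tau>: "0 < \<tau> i" "\<tau> i \<le> T" for i by (simp_all add: assms(2) T_def)
  have T: "0 \<le> T" using \<tau>[of undefined] by linarith
  define M where "M = sqrt (\<kappa> / \<delta>) * (1 + real CARD('k))"
  have M: "0 \<le> M" using \<kappa>(2) \<open>\<delta> > 0\<close> by (simp add: M_def)
  define D0 where "D0 = A + B ** L ** C"
  define D where "D i = Ad i + B ** L ** Cd i" for i

  \<comment> \<open>The estimate for functions that are continuously differentiable on the whole line.\<close>
  have C1: "norm (x t) \<le> M * S * exp (- \<alpha> * t)"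
    if x: "\<And>t. (x has_vector_derivative x' t) (at t)" and x': "continuous_on UNIV x'"
      and dde: "\<And>t. 0 \<le> t \<Longrightarrow> x' t = D0 *v x t + (\<Sum>i\<in>UNIV. D i *v x (t - \<tau> i))"
      and S: "\<And>s. s \<in> {-T..0} \<Longrightarrow> norm (x s) \<le> S" and t: "0 \<le> t"
    for x x' S t
  proof -
    note st = x x' \<tau>(1)
    define W where "W s = (x s, history \<tau> x s)" for s
    define W' where "W' s = (x' s, history \<tau> x' s)" for s
    have W: "(W has_vector_derivative W' s) (at s)" for s
      unfolding W_def W'_def
      by (intro has_vector_derivative_Pair x has_vector_derivative_history[OF st])
    have diss: "W s \<bullet> \<P> (W' s) + \<alpha> * (W s \<bullet> \<P> (W s)) \<le> 0" if s: "0 \<le> s" for s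
    proof -
      define z :: "('m, 'k \<times> 'm) RL2" where "z = pie_state \<tau> x x' s"
      define u where "u = L *v C_op C Cd z"
      have Tz: "T_op z = W s"
        unfolding z_def W_def by (rule T_op_pie_state[OF st])
      have "x' s = A *v x s + (\<Sum>i\<in>UNIV. Ad i *v x (s - \<tau> i)) + B *v u"
        unfolding u_def z_def C_op_pie_state[OF st] closed_loop_matrices dde[OF s] D0_def D_def ..
      then have AB: "A_op A Ad \<tau> z + B_op B u = W' s"
        unfolding z_def A_op_pie_state[OF st] W'_def by (simp add: B_op_def)
      have "F *v u = Z *v C_op C Cd z" by (simp add: u_def FL)
      from Phi_op_quadratic_form[where \<C> = "C_op C Cd" and z = z,
          OF bounded_linear_T_op bounded_linear_B_op lin_P \<open>\<P> = adjoint \<P>\<close> this]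
      have "\<epsilon> / 2 * (norm (u - \<K> z))\<^sup>2 + W s \<bullet> \<P> (W' s) + \<alpha> * (W s \<bullet> \<P> (W s)) \<le> 0"
        using \<Phi>_nonpos[of "(u - \<K> z, z)"] unfolding Tz[symmetric] AB[symmetric] by simp
      moreover have "0 \<le> \<epsilon> / 2 * (norm (u - \<K> z))\<^sup>2" using \<open>\<epsilon> > 0\<close> by simp
      ultimately show ?thesis by linarith
    qed
    have "norm (x t) \<le> norm (W t)" unfolding W_def by (rule norm_fst_le)
    also have "\<dots> \<le> sqrt (\<kappa> / \<delta>) * norm (W 0) * exp (- \<alpha> * t)"
      by (rule coercive_decay_bound[OF coercive \<open>\<delta> > 0\<close> dissipation_imp_decay[OF W lin_P P_self diss t] \<kappa>])
    also have "\<dots> \<le> sqrt (\<kappa> / \<delta>) * ((1 + real CARD('k)) * S) * exp (- \<alpha> * t)"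
    proof -
      have "norm (history \<tau> x 0) \<le> real CARD('k) * S"
      proof (rule norm_history_le[OF continuous_on_x[OF st]])
        fix i and s :: real assume "s \<in> {-1..0}"
        then have "- T \<le> \<tau> i * s" "\<tau> i * s \<le> 0"
          using \<tau>[of i] mult_left_mono[of "-s" 1 "\<tau> i"] by (auto simp: mult_le_0_iff)
        then show "norm (x (0 + \<tau> i * s)) \<le> S" by (intro S) auto
      qed
      moreover have "norm (x 0) \<le> S" using S[of 0] T by auto
      ultimately have "norm (W 0) \<le> (1 + real CARD('k)) * S"
        unfolding W_def by (intro order_trans[OF norm_Pair_le]) (simp add: algebra_simps)
      then show ?thesis using \<kappa>(2) \<open>\<delta> > 0\<close>
        by (intro mult_right_mono mult_left_mono) auto
    qed
    finally show ?thesis by (simp add: M_def mult_ac)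
  qed

  have bound: "norm (x t) \<le> (M + 1) * (SUP t\<in>{-T..0}. norm (x0 t)) * exp (- \<alpha> * t)"
    if x0: "x0 \<in> sobolev (-T) 0"
      and x: "\<And>t. 0 \<le> t \<Longrightarrow> (x has_vector_derivative
        (A *v x t + (\<Sum>i\<in>UNIV. Ad i *v x (t - \<tau> i)) + B *v u t)) (at t within {0..})"
      and y: "\<And>t. 0 \<le> t \<Longrightarrow> y t = C *v x t + (\<Sum>i\<in>UNIV. Cd i *v x (t - \<tau> i))"
      and u: "\<And>t. 0 \<le> t \<Longrightarrow> u t = L *v y t"
      and init: "\<And>t. t \<in> {-T..0} \<Longrightarrow> x t = x0 t" and t: "0 \<le> t"
    for x0 x :: "real \<Rightarrow> real^'m" and u y t
  proof -
    define S where "S = (SUP t\<in>{-T..0}. norm (x0 t))"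
    \<comment> \<open>Freezing \<open>x\<close> at times before \<open>-T\<close> gives a function that is continuous on the whole line.\<close>
    define p where "p s = x (max (-T) s)" for s
    have p_eq: "p s = x s" if "-T \<le> s" for s using that by (simp add: p_def max_absorb2)
    have x0c: "continuous_on {-T..0} x0" using x0 by (simp add: sobolev_def)
    have "bdd_above ((\<lambda>t. norm (x0 t)) ` {-T..0})"
      by (intro bounded_imp_bdd_above compact_imp_bounded compact_continuous_image continuous_on_norm x0c) auto
    then have "norm (x0 s) \<le> S" if "s \<in> {-T..0}" for s
      unfolding S_def using that by (intro cSUP_upper)
    then have S: "norm (p s) \<le> S" if "s \<in> {-T..0}" for s
      using that p_eq[of s] init[of s] by simp
    have S0: "0 \<le> S" using order_trans[OF norm_ge_zero S[of 0]] T by simp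
    have dde: "(p has_vector_derivative D0 *v p s + (\<Sum>i\<in>UNIV. D i *v p (s - \<tau> i))) (at s within {0..})"
      if s: "0 \<le> s" for s
    proof -
      have "p (s - \<tau> i) = x (s - \<tau> i)" for i using \<tau>[of i] s by (intro p_eq) linarith
      then have "(x has_vector_derivative D0 *v p s + (\<Sum>i\<in>UNIV. D i *v p (s - \<tau> i))) (at s within {0..})"
        using x[OF s] u[OF s] y[OF s] p_eq[of s] T s by (simp add: D0_def D_def closed_loop_matrices)
      then show ?thesis
        by (rule has_vector_derivative_transform[rotated 2]) (use s T p_eq in auto)
    qed
    have p: "continuous_on UNIV p"
      unfolding p_def[abs_def] by (rule continuous_on_concat_solution[OF x0c init x T])
    have "norm (p t) \<le> M * S * exp (- \<alpha> * t)"
    proof (rule delay_bound_by_averaging[where p = p and ?D0.0 = D0 and D = D and \<tau> = \<tau> and T = T and S = S])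
      show "norm (x t) \<le> M * S' * exp (- \<alpha> * t)"
        if "\<And>t. (x has_vector_derivative x' t) (at t)" "continuous_on UNIV x'"
          "\<And>t. 0 \<le> t \<Longrightarrow> x' t = D0 *v x t + (\<Sum>i\<in>UNIV. D i *v x (t - \<tau> i))"
          "\<And>s. s \<in> {-T..0} \<Longrightarrow> norm (x s) \<le> S'" "0 \<le> t"
        for x x' S' t
        using that by (rule C1)
    qed (fact p dde S T M t)+
    also have "\<dots> \<le> (M + 1) * S * exp (- \<alpha> * t)"
      by (intro mult_right_mono S0) auto
    finally show ?thesis using p_eq[of t] T t by (simp add: S_def)
  qed
  show ?thesis
    unfolding T_def[symmetric]
  proof (intro exI[of _ "M + 1"] conjI ballI allI impI)
    show "0 < M + 1" using M by simp
    fix x0 x u y and t :: real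
    assume x0: "x0 \<in> sobolev (-T) 0" and t: "0 \<le> t"
      and sol: "(\<forall>t\<ge>0. (x has_vector_derivative
          (A *v x t + (\<Sum>i\<in>UNIV. Ad i *v x (t - \<tau> i)) + B *v u t)) (at t within {0..})) \<and>
        (\<forall>t\<ge>0. y t = C *v x t + (\<Sum>i\<in>UNIV. Cd i *v x (t - \<tau> i))) \<and>
        (\<forall>t\<ge>0. u t = L *v y t) \<and> (\<forall>t\<in>{-T..0}. x t = x0 t)"
    show "norm (x t) \<le> (M + 1) * (SUP t\<in>{-T..0}. norm (x0 t)) * exp (- \<alpha> * t)"
      by (rule bound[where u = u and y = y, OF x0 _ _ _ _ t]) (use sol in blast)+
  qed
qed

end
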